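(* Let $\mathbf{B}_1\in\mathbb{H}^{r\times s}_{r_1}$, $\mathbf{B}_2\in\mathbb{H}^{q\times s}_{r_2}$, $\mathbf{C}\in\mathbb{H}^{m\times s}$, let $\mathbf{N}=\mathbf{B}_2\mathbf{L}_{B_1}$ with $\operatorname{rank}\mathbf{N}=r_3$, and let $\mathbf{X}_1=\mathbf{C}\mathbf{B}_1^\dagger-\mathbf{C}\mathbf{N}^\dagger\mathbf{B}_2\mathbf{B}_1^\dagger=(x^{(1)}_{ij})\in\mathbb{H}^{m\times r}$ and $\mathbf{X}_2=\mathbf{C}\mathbf{N}^\dagger=(x^{(2)}_{gf})\in\mathbb{H}^{m\times q}$. Let $\mathbf{c}^{(1)}_{i.}$ and $\mathbf{c}^{(2)}_{i.}$ be the $i$th rows of $\mathbf{C}_1=\mathbf{C}\mathbf{B}_1^*$ and $\mathbf{C}_2=\mathbf{C}\mathbf{N}^*$, and $\tilde{\mathbf{b}}^{(2)}_{t.}$ the $t$th row of $\tilde{\mathbf{B}}_2=\mathbf{B}_2\mathbf{B}_1^*$. Then $$x^{(1)}_{ij}=\frac{\sum_{\alpha\in I_{r_1,r}\{j\}}\mathrm{rdet}_j\big((\mathbf{B}_1\mathbf{B}_1^* )_{j.}(\mathbf{c}^{(1)}_{i.})\big)^\alpha_\alpha}{\sum_{\alpha\in I_{r_1,r}}|\mathbf{B}_1\mathbf{B}_1^*|^\alpha_\alpha}-\frac{\sum_{t=1}^q\sum_{\alpha\in I_{r_3,q}\{t\}}\mathrm{rdet}_t\big((\mathbf{N}\mathbf{N}^*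 )_{t.}(\mathbf{c}^{(2)}_{i.})\big)^\alpha_\alpha\sum_{\alpha\in I_{r_1,r}\{j\}}\mathrm{rdet}_j\big((\mathbf{B}_1\mathbf{B}_1^* )_{j.}(\tilde{\mathbf{b}}^{(2)}_{t.})\big)^\alpha_\alpha}{\sum_{\alpha\in I_{r_3,q}}|\mathbf{N}\mathbf{N}^*|^\alpha_\alpha\sum_{\alpha\in I_{r_1,r}}|\mathbf{B}_1\mathbf{B}_1^*|^\alpha_\alpha},$$ $$x^{(2)}_{gf}=\frac{\sum_{\alpha\in I_{r_3,q}\{f\}}\mathrm{rdet}_f\big((\mathbf{N}\mathbf{N}^* )_{f.}(\mathbf{c}^{(2)}_{g.})\big)^\alpha_\alpha}{\sum_{\alpha\in I_{r_3,q}}|\mathbf{N}\mathbf{N}^*|^\alpha_\alpha}.$$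
   Context: $\mathbb{H}$ is the skew field of real quaternions; $\mathbb{H}^{m\times n}$ is the set of $m\times n$ matrices over $\mathbb{H}$ and $\mathbb{H}^{m\times n}_r$ the subset of those of rank $r$. $\mathbf{A}^*$ is the conjugate transpose and $\mathbf{A}^\dagger$ the Moore–Penrose inverse (the unique $\mathbf{X}$ with $\mathbf{AXA}=\mathbf{A}$, $\mathbf{XAX}=\mathbf{X}$, $(\mathbf{AX})^*=\mathbf{AX}$, $(\mathbf{XA})^*=\mathbf{XA}$). $\mathbf{L}_A=\mathbf{I}-\mathbf{A}^\dagger\mathbf{A}$. For a matrix $\mathbf{F}$, $\mathbf{F}_{i.}(\mathbf{b})$ is $\mathbf{F}$ with its $i$th row replaced by the row $\mathbf{b}$. Row determinants: for $\mathbf{F}=(a_{ij})\in\mathbb{H}^{n\times n}$, $\mathrm{rdet}_i\mathbf{F}=\sum_{\sigma\in S_n}(-1)^{n-r}(a_{i\,i_{k_1}}a_{i_{k_1}i_{k_1+1}}\cdots a_{i_{k_1+l_1}i})\cdots(a_{i_{k_r}i_{k_r+1}}\cdots a_{i_{k_r+l_r}i_{k_r}})$, where $\sigma=(i\,i_{k_1}\,i_{k_1+1}\cdots i_{k_1+l_1})(i_{k_2}\cdots i_{k_2+l_2})\cdots(i_{k_r}\cdots i_{k_r+l_r})$ is the decomposition of $\sigma$ into $r$ disjoint cycles (fixed points included) with $i_{k_2}<\cdots<i_{k_r}$ and $i_{k_t}<i_{k_t+s}$ for $t=2,\dots,r$, $s=1,\dots,l_t$. For Hermitian $\mathbf{F}$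 all $\mathrm{rdet}_i\mathbf{F}$ coincide and are real; this value is $\det\mathbf{F}$. Index sets: $L_{k,n}$ is the set of strictly increasing sequences $\alpha=(\alpha_1<\cdots<\alpha_k)$ in $\{1,\dots,n\}$; $I_{k,m}\{i\}=\{\alpha\in L_{k,m}: i\in\alpha\}$; sums over $I_{k,m}$ without braces run over all of $L_{k,m}$. For a square $\mathbf{F}$, $\mathbf{F}^\alpha_\alpha$ is the principal submatrix with rows and columns indexed by $\alpha$; $\mathrm{rdet}_j(\mathbf{G})^\alpha_\alpha$ is the row determinant of the principal submatrix $\mathbf{G}^\alpha_\alpha$ taken at the row coming from index $j$; for Hermitian $\mathbf{F}$, $|\mathbf{F}|^\alpha_\alpha=\det\mathbf{F}^\alpha_\alpha$. *)

theory Defs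
  imports Complex_Main "HOL-Combinatorics.Permutations"
begin

datatype quat = Quat (Re: real) (Im1: real) (Im2: real) (Im3: real)

lemma quat_eqI: "Re x = Re y \<Longrightarrow> Im1 x = Im1 y \<Longrightarrow> Im2 x = Im2 y \<Longrightarrow> Im3 x = Im3 y \<Longrightarrow> x = y"
  by (cases x, cases y) simp

instantiation quat :: ring_1
begin
definition "0 = Quat 0 0 0 0"
definition "1 = Quat 1 0 0 0"
definition "x + y = Quat (Re x + Re y) (Im1 x + Im1 y) (Im2 x + Im2 y) (Im3 x + Im3 y)"
definition "x - y = Quat (Re x - Re y) (Im1 x - Im1 y) (Im2 x - Im2 y) (Im3 x - Im3 y)"
definition "- x = Quat (- Re x) (- Im1 x) (- Im2 x) (- Im3 x)"
definition "x * y = Quat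
   (Re x * Re y - Im1 x * Im1 y - Im2 x * Im2 y - Im3 x * Im3 y)
   (Re x * Im1 y + Im1 x * Re y + Im2 x * Im3 y - Im3 x * Im2 y)
   (Re x * Im2 y - Im1 x * Im3 y + Im2 x * Re y + Im3 x * Im1 y)
   (Re x * Im3 y + Im1 x * Im2 y - Im2 x * Im1 y + Im3 x * Re y)"
instance
  by standard (auto intro!: quat_eqI simp: zero_quat_def one_quat_def plus_quat_def
      minus_quat_def uminus_quat_def times_quat_def algebra_simps)
end

instantiation quat :: inverse
begin
definition "inverse x = (let d = (Re x)\<^sup>2 + (Im1 x)\<^sup>2 + (Im2 x)\<^sup>2 + (Im3 x)\<^sup>2 in
   Quat (Re x / d) (- Im1 x / d) (- Im2 x / d) (- Im3 x / d))"
definition "x div (y::quat) = x * inverse y"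
instance ..
end

definition qcnj :: "quat \<Rightarrow> quat" where
  "qcnj x = Quat (Re x) (- Im1 x) (- Im2 x) (- Im3 x)"

text \<open>A matrix is a function of (0-based) row and column indices; an m\<times>n matrix
  is one whose entries vanish outside rows < m and columns < n.\<close>
type_synonym qmat = "nat \<Rightarrow> nat \<Rightarrow> quat"

definition is_qmat :: "nat \<Rightarrow> nat \<Rightarrow> qmat \<Rightarrow> bool" where
  "is_qmat m n A \<longleftrightarrow> (\<forall>i j. (m \<le> i \<or> n \<le> j) \<longrightarrow> A i j = 0)"

definition qmult :: "nat \<Rightarrow> qmat \<Rightarrow> qmat \<Rightarrow> qmat" where
  "qmult n A B = (\<lambda>i j. \<Sum>k<n. A i k * B k j)"

definition qadj :: "qmat \<Rightarrow> qmat" where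
  "qadj A = (\<lambda>i j. qcnj (A j i))"

definition qid :: "nat \<Rightarrow> qmat" where
  "qid n = (\<lambda>i j. if i = j \<and> i < n then 1 else 0)"

definition qsub :: "qmat \<Rightarrow> qmat \<Rightarrow> qmat" where
  "qsub A B = (\<lambda>i j. A i j - B i j)"

definition qmp :: "nat \<Rightarrow> nat \<Rightarrow> qmat \<Rightarrow> qmat" where
  "qmp m n A = (THE X. is_qmat n m X \<and>
      qmult m (qmult n A X) A = A \<and> qmult n (qmult m X A) X = X \<and>
      qadj (qmult n A X) = qmult n A X \<and> qadj (qmult m X A) = qmult m X A)"

definition qL :: "nat \<Rightarrow> nat \<Rightarrow> qmat \<Rightarrow> qmat" where
  "qL m n A = qsub (qid n) (qmult m (qmp m n A) A)"

definition qcols_indep :: "nat \<Rightarrow> qmat \<Rightarrow> nat set \<Rightarrow> bool" where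
  "qcols_indep m A J \<longleftrightarrow>
     (\<forall>c. (\<forall>i<m. (\<Sum>j\<in>J. A i j * c j) = 0) \<longrightarrow> (\<forall>j\<in>J. c j = 0))"

definition qrank :: "nat \<Rightarrow> nat \<Rightarrow> qmat \<Rightarrow> nat" where
  "qrank m n A = Max {card J | J. J \<subseteq> {..<n} \<and> qcols_indep m A J}"

definition cyc_len :: "(nat \<Rightarrow> nat) \<Rightarrow> nat \<Rightarrow> nat" where
  "cyc_len \<sigma> x = (LEAST k. 0 < k \<and> (\<sigma> ^^ k) x = x)"

definition cyc_orbit :: "(nat \<Rightarrow> nat) \<Rightarrow> nat \<Rightarrow> nat set" where
  "cyc_orbit \<sigma> x = {(\<sigma> ^^ k) x | k. True}"

definition cyc_prod :: "qmat \<Rightarrow> (nat \<Rightarrow> nat) \<Rightarrow> nat \<Rightarrow> quat" where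
  "cyc_prod F \<sigma> x = prod_list (map (\<lambda>k. F ((\<sigma> ^^ k) x) ((\<sigma> ^^ Suc k) x)) [0..<cyc_len \<sigma> x])"

definition other_cyc_heads :: "nat \<Rightarrow> nat \<Rightarrow> (nat \<Rightarrow> nat) \<Rightarrow> nat list" where
  "other_cyc_heads n i \<sigma> = sorted_list_of_set
     {x. x < n \<and> x \<notin> cyc_orbit \<sigma> i \<and> x = Min (cyc_orbit \<sigma> x)}"

definition rdet :: "nat \<Rightarrow> nat \<Rightarrow> qmat \<Rightarrow> quat" where
  "rdet n i F = (\<Sum>\<sigma> | \<sigma> permutes {..<n}.
     (let hs = i # other_cyc_heads n i \<sigma> in
       (-1) ^ (n - length hs) * prod_list (map (cyc_prod F \<sigma>) hs)))"

text \<open>Determinant of a Hermitian n\<times>n matrix (all row determinants coincide);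
  for n = 0 it is 1.\<close>
definition hdet :: "nat \<Rightarrow> qmat \<Rightarrow> quat" where
  "hdet n F = (if n = 0 then 1 else rdet n 0 F)"

definition row_repl :: "qmat \<Rightarrow> nat \<Rightarrow> (nat \<Rightarrow> quat) \<Rightarrow> qmat" where
  "row_repl F i b = (\<lambda>p q. if p = i then b q else F p q)"

definition psub :: "nat set \<Rightarrow> qmat \<Rightarrow> qmat" where
  "psub \<alpha> F = (\<lambda>a b. if a < card \<alpha> \<and> b < card \<alpha>
      then F (sorted_list_of_set \<alpha> ! a) (sorted_list_of_set \<alpha> ! b) else 0)"

text \<open>rdet_j (G)^\<alpha>_\<alpha>: row determinant of the principal submatrix at the row coming from j.\<close>
definition rdet_sub :: "nat \<Rightarrow> nat set \<Rightarrow> qmat \<Rightarrow> quat" where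
  "rdet_sub j \<alpha> G = rdet (card \<alpha>) (card {x\<in>\<alpha>. x < j}) (psub \<alpha> G)"

definition hdet_sub :: "nat set \<Rightarrow> qmat \<Rightarrow> quat" where
  "hdet_sub \<alpha> F = hdet (card \<alpha>) (psub \<alpha> F)"

definition Lset :: "nat \<Rightarrow> nat \<Rightarrow> nat set set" where
  "Lset k n = {\<alpha>. \<alpha> \<subseteq> {..<n} \<and> card \<alpha> = k}"

definition Iset :: "nat \<Rightarrow> nat \<Rightarrow> nat \<Rightarrow> nat set set" where
  "Iset k n i = {\<alpha> \<in> Lset k n. i \<in> \<alpha>}"

end

theory Submission
  imports Defs "HOL-Combinatorics.Cycles"
begin

text \<open>
  Everything reduces to one formula: if \<open>A\<close> has rank \<open>p\<close> and \<open>H = A A\<^sup>*\<close>, then the entries of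
  \<open>y = c A\<^sup>\<dagger>\<close> are quotients of row determinants of \<open>H\<close> with one row replaced by \<open>c A\<^sup>*\<close>.
  Here \<open>y H = c A\<^sup>*\<close>, and \<open>y = g A\<^sup>*\<close> for some \<open>g\<close>.

  Write \<open>R(S, j, v)\<close> for the row determinant at \<open>j\<close> of the principal submatrix \<open>H\<^sub>S\<close> with row
  \<open>j\<close> replaced by \<open>v\<close>, and expand it along the cycle through \<open>j\<close>. Reversing a cycle of a
  Hermitian matrix conjugates its product, so only real parts of the other cycles survive, and
  an involution that splits or joins the cycles through two indices gives
  \<open>R(S, j, h\<^sub>k) = \<delta>\<^sub>j\<^sub>k det H\<^sub>S\<close> for \<open>j, k \<in> S\<close>, where \<open>h\<^sub>k\<close> is a row of \<open>H\<close>. Expanding by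
  linearity, the sum of \<open>R(S, j, y H)\<close> over \<open>\<bar>S\<bar> = p\<close> plus the sum of \<open>R(S, j, y)\<close> over
  \<open>\<bar>S\<bar> = p + 1\<close> equals \<open>y\<^sub>j\<close> times the sum of the \<open>det H\<^sub>S\<close> over \<open>\<bar>S\<bar> = p\<close>. The second sum
  vanishes: on \<open>S\<close>, the row \<open>g A\<^sup>*\<close> is a combination of the rows \<open>h\<^sub>k\<close> with \<open>k \<in> S\<close>, and
  \<open>det H\<^sub>S = 0\<close>. Gram-Schmidt shows \<open>det H\<^sub>S \<ge> 0\<close>, with equality exactly when the rows of \<open>A\<close>
  in \<open>S\<close> are dependent, so the sum of the \<open>det H\<^sub>S\<close> over \<open>\<bar>S\<bar> = p\<close> is not zero.
\<close>

section \<open>Quaternion arithmetic\<close>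

instance quat :: division_ring
proof
  fix a :: quat
  assume a: "a \<noteq> 0"
  let ?d = "(Re a)\<^sup>2 + (Im1 a)\<^sup>2 + (Im2 a)\<^sup>2 + (Im3 a)\<^sup>2"
  have d: "?d \<noteq> 0"
  proof
    assume "?d = 0"
    moreover have "0 \<le> (Re a)\<^sup>2" "0 \<le> (Im1 a)\<^sup>2" "0 \<le> (Im2 a)\<^sup>2" "0 \<le> (Im3 a)\<^sup>2"
      by simp_all
    ultimately have "(Re a)\<^sup>2 = 0" "(Im1 a)\<^sup>2 = 0" "(Im2 a)\<^sup>2 = 0" "(Im3 a)\<^sup>2 = 0"
      by linarith+
    with a show False
      by (auto intro: quat_eqI simp: zero_quat_def)
  qed
  define d where "d = ?d"
  have "inverse a = Quat (Re a / d) (- Im1 a / d) (- Im2 a / d) (- Im3 a / d)"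
    by (simp add: inverse_quat_def Let_def d_def)
  moreover have "d \<noteq> 0" "Re a * Re a + Im1 a * Im1 a + Im2 a * Im2 a + Im3 a * Im3 a = d"
    using d by (simp_all add: d_def power2_eq_square)
  ultimately show "inverse a * a = 1" "a * inverse a = 1"
    by (auto intro!: quat_eqI simp: times_quat_def one_quat_def field_simps)
next
  show "\<And>a b :: quat. a / b = a * inverse b"
    by (rule divide_quat_def)
  show "inverse (0 :: quat) = 0"
    by (simp add: inverse_quat_def zero_quat_def)
qed

lemma quat_sel_arith [simp]:
  "Re 0 = 0" "Im1 0 = 0" "Im2 0 = 0" "Im3 0 = 0"
  "Re 1 = 1" "Im1 1 = 0" "Im2 1 = 0" "Im3 1 = 0"
  "Re (x + y) = Re x + Re y" "Im1 (x + y) = Im1 x + Im1 y"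
  "Im2 (x + y) = Im2 x + Im2 y" "Im3 (x + y) = Im3 x + Im3 y"
  "Re (- x) = - Re x" "Im1 (- x) = - Im1 x" "Im2 (- x) = - Im2 x" "Im3 (- x) = - Im3 x"
  "Re (x - y) = Re x - Re y" "Im1 (x - y) = Im1 x - Im1 y"
  "Im2 (x - y) = Im2 x - Im2 y" "Im3 (x - y) = Im3 x - Im3 y"
  by (simp_all add: zero_quat_def one_quat_def plus_quat_def minus_quat_def uminus_quat_def)

lemma quat_Re_sum: "Re (sum f A) = (\<Sum>x\<in>A. Re (f x))"
  by (induct A rule: infinite_finite_induct) simp_all

lemma quat_Re_mult_commute: "Re (x * y) = Re (y * x)"
  by (simp add: times_quat_def)

lemma qcnj_simps [simp]:
  "qcnj 0 = 0" "qcnj 1 = 1" "qcnj (qcnj x) = x"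
  "qcnj (x + y) = qcnj x + qcnj y" "qcnj (x - y) = qcnj x - qcnj y" "qcnj (- x) = - qcnj x"
  "qcnj (x * y) = qcnj y * qcnj x"
  by (auto intro!: quat_eqI simp: qcnj_def times_quat_def algebra_simps)

lemma qcnj_sum: "qcnj (sum f A) = (\<Sum>x\<in>A. qcnj (f x))"
  by (induct A rule: infinite_finite_induct) simp_all

lemma qcnj_minus_one_power [simp]: "qcnj ((- 1) ^ n) = (- 1) ^ n"
  by (induct n) simp_all

lemma minus_one_power_central: "(- 1) ^ n * (x :: 'a :: ring_1) = x * (- 1) ^ n"
  by (induct n) simp_all

lemma qcnj_fixed_iff: "qcnj x = x \<longleftrightarrow> x = Quat (Re x) 0 0 0"
  by (cases x) (auto simp: qcnj_def)

lemma qcnj_fixed_central: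
  assumes "qcnj a = a"
  shows "a * x = x * a"
proof -
  obtain r where "a = Quat r 0 0 0"
    using assms qcnj_fixed_iff by blast
  then show ?thesis
    by (auto intro: quat_eqI simp: times_quat_def)
qed

lemma qcnj_fixed_eqI:
  assumes "qcnj x = x" "qcnj y = y" "Re x = Re y"
  shows "x = y"
  using assms by (metis qcnj_fixed_iff)

lemma qcnj_fixed_inverse:
  assumes "qcnj a = a"
  shows "qcnj (inverse a) = inverse a"
  using assms unfolding qcnj_fixed_iff by (cases a) (auto simp: inverse_quat_def Let_def)

lemma Re_mult_fixed:
  assumes "qcnj a = a"
  shows "Re (a * x) = Re a * Re x"
  using assms unfolding qcnj_fixed_iff by (cases a) (auto simp: times_quat_def)

lemma Re_mult_qcnj_nonneg: "0 \<le> Re (x * qcnj x)"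
  by (simp add: times_quat_def qcnj_def)

lemma Re_mult_qcnj_eq_0: "Re (x * qcnj x) = 0 \<longleftrightarrow> x = 0"
proof
  assume h: "Re (x * qcnj x) = 0"
  have "(Re x)\<^sup>2 + (Im1 x)\<^sup>2 + (Im2 x)\<^sup>2 + (Im3 x)\<^sup>2 = 0"
    using h by (simp add: times_quat_def qcnj_def power2_eq_square)
  then have "x = Quat 0 0 0 0"
    by (cases x) (simp add: add_nonneg_eq_0_iff)
  then show "x = 0" by (simp add: zero_quat_def)
qed simp

section \<open>Splitting a cycle off a permutation\<close>

definition distinct_lists :: "'a set \<Rightarrow> 'a list set" where
  "distinct_lists T = {xs. distinct xs \<and> set xs \<subseteq> T}"

lemma finite_distinct_lists [simp]: "finite T \<Longrightarrow> finite (distinct_lists T)"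
  using finite_subset_distinct[of T] by (simp add: distinct_lists_def conj_commute)

text \<open>The product of the weights along the walk through \<open>xs\<close> to \<open>j\<close>, where the first step is
  taken out of the row \<open>v\<close>, which need not be a row of \<open>F\<close>.\<close>

fun walk :: "qmat \<Rightarrow> (nat \<Rightarrow> quat) \<Rightarrow> nat list \<Rightarrow> nat \<Rightarrow> quat" where
  "walk F v [] j = v j"
| "walk F v (x # xs) j = v x * walk F (F x) xs j"

text \<open>Connects the product over exponents in \<open>cyc_prod\<close> with the recursive
  \<open>walk\<close>; the start \<open>a\<close> is arbitrary because each induction step moves it
  by one.\<close>

lemma prod_list_walk:
  "prod_list (map (\<lambda>k. F (g k) (g (Suc k))) [a..<a + Suc d])
     = walk F (F (g a)) (map g [Suc a..<a + Suc d]) (g (a + Suc d))"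
proof (induct d arbitrary: a)
  case 0
  then show ?case by simp
next
  case (Suc d)
  have "[a..<a + Suc (Suc d)] = a # [Suc a..<Suc a + Suc d]"
    by (simp add: upt_rec)
  moreover have "[Suc a..<a + Suc (Suc d)] = Suc a # [Suc (Suc a)..<Suc a + Suc d]"
    by (simp add: upt_rec)
  ultimately show ?case
    using Suc[of "Suc a"] by simp
qed

lemma cyc_len_eq_least_power: "cyc_len = least_power"
  by (simp add: fun_eq_iff cyc_len_def least_power_def conj_commute)

lemma finite_permutation: "finite T \<Longrightarrow> \<sigma> permutes T \<Longrightarrow> permutation \<sigma>"
  unfolding permutation_permutes by blast

lemma cyc_orbit_eq_support: "permutation \<sigma> \<Longrightarrow> cyc_orbit \<sigma> x = set (support \<sigma> x)"
  by (subst support_set) (auto simp: cyc_orbit_def)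

lemma support_eq_Cons:
  assumes "permutation \<sigma>"
  shows "support \<sigma> x = x # map (\<lambda>k. (\<sigma> ^^ k) x) [1..<least_power \<sigma> x]"
  using least_power_of_permutation(2)[OF assms, of x] by (simp add: upt_conv_Cons)

lemma cyc_prod_eq_walk:
  assumes "permutation \<sigma>"
  shows "cyc_prod F \<sigma> x = walk F (F x) (tl (support \<sigma> x)) x"
proof -
  obtain d where d: "least_power \<sigma> x = Suc d"
    using least_power_of_permutation(2)[OF assms, of x] by (metis Suc_pred)
  have "(\<sigma> ^^ Suc d) x = x"
    using least_power_of_permutation(1)[OF assms, of x] d by simp
  then show ?thesis
    using prod_list_walk[of F "\<lambda>k. (\<sigma> ^^ k) x" 0 d] d
    by (simp add: cyc_prod_def cyc_len_eq_least_power upt_conv_Cons[of 0] del: upt_Suc)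
qed

lemma funpow_eq_on_invariant:
  assumes "x \<in> A" "\<And>y. y \<in> A \<Longrightarrow> f y = g y" "\<And>y. y \<in> A \<Longrightarrow> g y \<in> A"
  shows "(f ^^ k) x = (g ^^ k) x \<and> (g ^^ k) x \<in> A"
  using assms by (induct k) auto

text \<open>On the entries of the cycle \<open>\<tau>\<close> is the identity, so the iterates of
  \<open>x\<close> are those under the cycle alone, which rotates the list.\<close>

lemma support_cycle_comp:
  assumes "distinct (x # xs)" "\<tau> permutes U" "set (x # xs) \<inter> U = {}"
  shows "support (cycle_of_list (x # xs) \<circ> \<tau>) x = x # xs"
proof -
  let ?c = "cycle_of_list (x # xs)" and ?n = "length (x # xs)"
  let ?s = "?c \<circ> \<tau>"
  have cA: "?c y \<in> set (x # xs)" if "y \<in> set (x # xs)" for y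
    using cycle_is_surj[OF assms(1)] that by blast
  have sc: "?s y = ?c y" if "y \<in> set (x # xs)" for y
    using assms(2,3) that by (auto simp: permutes_def)
  have pow: "(?s ^^ k) x = (x # xs) ! (k mod ?n)" for k
  proof -
    have "(?s ^^ k) x = (?c ^^ k) x"
      by (rule conjunct1[OF funpow_eq_on_invariant[where A = "set (x # xs)"]])
        (use sc cA in auto)
    also have "\<dots> = map (?c ^^ k) (x # xs) ! 0"
      by simp
    also have "\<dots> = rotate k (x # xs) ! 0"
      by (simp only: cyclic_rotation[OF assms(1)])
    also have "\<dots> = (x # xs) ! (k mod ?n)"
      by (subst nth_rotate) simp_all
    finally show ?thesis .
  qed
  have lp: "least_power ?s x = ?n"
    unfolding least_power_def
  proof (rule Least_equality)
    show "(?s ^^ ?n) x = x \<and> 0 < ?n"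
      unfolding pow by simp
  next
    fix k assume k: "(?s ^^ k) x = x \<and> 0 < k"
    show "?n \<le> k"
    proof (rule ccontr)
      assume "\<not> ?n \<le> k"
      then have "k < ?n" by simp
      then have "(x # xs) ! k = (x # xs) ! 0"
        using k pow[of k] by simp
      then show False
        using \<open>k < ?n\<close> k nth_eq_iff_index_eq[OF assms(1), of k 0] by simp
    qed
  qed
  show ?thesis
    by (rule nth_equalityI) (simp_all only: lp length_map length_upt pow nth_map_upt, simp_all)
qed

definition perm_restrict :: "'a set \<Rightarrow> ('a \<Rightarrow> 'a) \<Rightarrow> 'a \<Rightarrow> 'a" where
  "perm_restrict A \<sigma> = (\<lambda>y. if y \<in> A then \<sigma> y else y)"

lemma orbit_complement_invariant:
  assumes "finite T" "\<sigma> permutes T" "y \<in> T - set (support \<sigma> x)"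
  shows "\<sigma> y \<in> T - set (support \<sigma> x)"
proof -
  let ?q = "\<lambda>y. if y \<in> T - set (support \<sigma> x) then \<sigma> y else y"
  have "?q permutes (T - set (support \<sigma> x))"
    by (rule semidecomposition[OF assms(2,1)])
  from permutes_in_image[OF this, of y] have "?q y \<in> T - set (support \<sigma> x)"
    using assms(3) by (simp only:)
  then show ?thesis
    unfolding if_P[OF assms(3)] .
qed

lemma support_subset:
  assumes "finite T" "\<sigma> permutes T" "x \<in> T"
  shows "set (support \<sigma> x) \<subseteq> T"
  using permutes_in_image[OF permutes_funpow[OF assms(2)]] assms(3) by auto

lemma cycle_comp_restrict:
  assumes "finite T" "\<sigma> permutes T"
  shows "cycle_of_list (support \<sigma> x) \<circ> perm_restrict (T - set (support \<sigma> x)) \<sigma> = \<sigma>"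
proof
  fix y
  note p = finite_permutation[OF assms]
  let ?A = "set (support \<sigma> x)"
  consider "y \<in> T - ?A" | "y \<in> ?A" | "y \<notin> T" "y \<notin> ?A" by blast
  then show "(cycle_of_list (support \<sigma> x) \<circ> perm_restrict (T - ?A) \<sigma>) y = \<sigma> y"
  proof cases
    case 1
    then show ?thesis
      using orbit_complement_invariant[OF assms 1]
      by (simp add: perm_restrict_def id_outside_supp del: set_map)
  next
    case 2
    then show ?thesis
      using cycle_restrict[OF p 2] by (simp add: perm_restrict_def del: set_map)
  next
    case 3
    then show ?thesis
      using assms(2) by (simp add: perm_restrict_def id_outside_supp permutes_not_in del: set_map)
  qed
qed

lemma perm_restrict_permutes:
  assumes "finite T" "\<sigma> permutes T"
  shows "perm_restrict (T - set (support \<sigma> x)) \<sigma> permutes (T - set (support \<sigma> x))"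
  using semidecomposition[OF assms(2,1), of x] unfolding perm_restrict_def .

lemma perm_restrict_cycle_comp:
  assumes "\<tau> permutes U" "set cs \<inter> U = {}"
  shows "perm_restrict U (cycle_of_list cs \<circ> \<tau>) = \<tau>"
proof
  fix y
  show "perm_restrict U (cycle_of_list cs \<circ> \<tau>) y = \<tau> y"
  proof (cases "y \<in> U")
    case True
    then have "\<tau> y \<notin> set cs"
      using assms permutes_in_image[OF assms(1)] by blast
    then show ?thesis
      using True by (simp add: perm_restrict_def id_outside_supp)
  qed (use assms in \<open>simp add: perm_restrict_def permutes_not_in\<close>)
qed

text \<open>A permutation of \<open>T\<close> amounts to its cycle through \<open>x\<close>,
  recorded as the list of entries after \<open>x\<close>, together with a permutation of the indices
  off that cycle.\<close>

lemma sum_permutes_split_cycle: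
  assumes T: "finite T" "x \<in> T"
  shows "(\<Sum>\<sigma> | \<sigma> permutes T. f (tl (support \<sigma> x)) (perm_restrict (T - set (support \<sigma> x)) \<sigma>))
    = (\<Sum>xs\<in>distinct_lists (T - {x}). \<Sum>\<tau> | \<tau> permutes (T - set (x # xs)). f xs \<tau>)"
proof -
  have sup: "support \<sigma> x = x # tl (support \<sigma> x)" if "\<sigma> permutes T" for \<sigma>
    using support_eq_Cons[OF finite_permutation[OF T(1) that], of x] by simp
  have dis: "distinct (support \<sigma> x)" if "\<sigma> permutes T" for \<sigma>
    using cycle_of_permutation[OF finite_permutation[OF T(1) that]] .
  let ?S = "SIGMA xs:distinct_lists (T - {x}). {\<tau>. \<tau> permutes (T - set (x # xs))}"
  have "(\<Sum>\<sigma> | \<sigma> permutes T. f (tl (support \<sigma> x)) (perm_restrict (T - set (support \<sigma> x)) \<sigma>))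
     = (\<Sum>(xs, \<tau>)\<in>?S. f xs \<tau>)"
  proof (rule sum.reindex_bij_witness[where i = "\<lambda>(xs, \<tau>). cycle_of_list (x # xs) \<circ> \<tau>"
        and j = "\<lambda>\<sigma>. (tl (support \<sigma> x), perm_restrict (T - set (support \<sigma> x)) \<sigma>)"])
    fix \<sigma> assume "\<sigma> \<in> {\<sigma>. \<sigma> permutes T}"
    then have s: "\<sigma> permutes T" by simp
    show "(case (tl (support \<sigma> x), perm_restrict (T - set (support \<sigma> x)) \<sigma>) of
        (xs, \<tau>) \<Rightarrow> cycle_of_list (x # xs) \<circ> \<tau>) = \<sigma>"
      using cycle_comp_restrict[OF T(1) s, of x] sup[OF s] by simp
    have "tl (support \<sigma> x) \<in> distinct_lists (T - {x})"
      using dis[OF s] sup[OF s] support_subset[OF T(1) s T(2)]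
      unfolding distinct_lists_def
      by (smt (verit) Diff_iff distinct.simps(2) distinct_tl list.set_intros(2) mem_Collect_eq singletonD subset_iff)
    moreover have "perm_restrict (T - set (support \<sigma> x)) \<sigma> permutes (T - set (x # tl (support \<sigma> x)))"
      using perm_restrict_permutes[OF T(1) s, of x] sup[OF s] by simp
    ultimately show "(tl (support \<sigma> x), perm_restrict (T - set (support \<sigma> x)) \<sigma>) \<in> ?S"
      by blast
  next
    fix b assume "b \<in> ?S"
    then obtain xs \<tau> where b: "b = (xs, \<tau>)" "distinct (x # xs)" "set (x # xs) \<subseteq> T"
        "\<tau> permutes (T - set (x # xs))"
      using T(2) by (auto simp: distinct_lists_def)
    have sp: "support (cycle_of_list (x # xs) \<circ> \<tau>) x = x # xs"
      by (rule support_cycle_comp[OF b(2,4)]) blast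
    have "perm_restrict (T - set (x # xs)) (cycle_of_list (x # xs) \<circ> \<tau>) = \<tau>"
      by (rule perm_restrict_cycle_comp[OF b(4)]) blast
    with sp show "(tl (support (case b of (xs, \<tau>) \<Rightarrow> cycle_of_list (x # xs) \<circ> \<tau>) x),
        perm_restrict (T - set (support (case b of (xs, \<tau>) \<Rightarrow> cycle_of_list (x # xs) \<circ> \<tau>) x))
          (case b of (xs, \<tau>) \<Rightarrow> cycle_of_list (x # xs) \<circ> \<tau>)) = b"
      unfolding b(1) by (simp only: prod.case list.sel)
    have "cycle_of_list (x # xs) \<circ> \<tau> permutes T"
      by (rule permutes_compose) (auto intro: permutes_subset[OF b(4)] permutes_subset[OF cycle_permutes b(3)])
    then show "(case b of (xs, \<tau>) \<Rightarrow> cycle_of_list (x # xs) \<circ> \<tau>) \<in> {\<sigma>. \<sigma> permutes T}"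
      by (simp add: b(1))
  qed simp
  also have "\<dots> = (\<Sum>xs\<in>distinct_lists (T - {x}). \<Sum>\<tau> | \<tau> permutes (T - set (x # xs)). f xs \<tau>)"
    by (rule sum.Sigma[symmetric]) (use T(1) in \<open>auto simp: finite_permutations\<close>)
  finally show ?thesis .
qed

section \<open>Row determinants as sums over walks\<close>

definition cyc_heads :: "nat set \<Rightarrow> (nat \<Rightarrow> nat) \<Rightarrow> nat set" where
  "cyc_heads T \<tau> = {y \<in> T. y = Min (cyc_orbit \<tau> y)}"

definition perm_term :: "qmat \<Rightarrow> nat set \<Rightarrow> (nat \<Rightarrow> nat) \<Rightarrow> quat" where
  "perm_term F T \<tau> = (let hs = sorted_list_of_set (cyc_heads T \<tau>) in
     (- 1) ^ (card T - length hs) * prod_list (map (cyc_prod F \<tau>) hs))"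

text \<open>As in the row determinant, but every cycle is read from its least element; for Hermitian
  \<open>F\<close> this is the determinant of the principal submatrix on \<open>T\<close>, without renumbering the
  indices.\<close>

definition gdet :: "qmat \<Rightarrow> nat set \<Rightarrow> quat" where
  "gdet F T = (\<Sum>\<tau> | \<tau> permutes T. perm_term F T \<tau>)"

text \<open>For \<open>j \<notin> T\<close> this is the row determinant at \<open>j\<close> of the principal submatrix on
  \<open>insert j T\<close> in which row \<open>j\<close> has been replaced by \<open>v\<close>: the list \<open>xs\<close> is the rest of the
  cycle through \<open>j\<close>.\<close>

definition walk_sum :: "qmat \<Rightarrow> nat set \<Rightarrow> (nat \<Rightarrow> quat) \<Rightarrow> nat \<Rightarrow> quat" where
  "walk_sum F T v j =
     (\<Sum>xs\<in>distinct_lists T. (- 1) ^ length xs * walk F v xs j * gdet F (T - set xs))"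

lemma gdet_empty [simp]: "gdet F {} = 1"
proof -
  have "{\<tau>. \<tau> permutes ({} :: nat set)} = {id}"
    by (auto simp: permutes_empty)
  then show ?thesis
    by (simp add: gdet_def perm_term_def cyc_heads_def)
qed

lemma restrict_orbit_eq:
  assumes "finite T" "\<sigma> permutes T" "y \<in> T - set (support \<sigma> x)"
  defines "\<tau> \<equiv> perm_restrict (T - set (support \<sigma> x)) \<sigma>"
  shows "cyc_orbit \<sigma> y = cyc_orbit \<tau> y" "cyc_prod F \<sigma> y = cyc_prod F \<tau> y"
proof -
  let ?U = "T - set (support \<sigma> x)"
  have "(\<tau> ^^ k) y = (\<sigma> ^^ k) y \<and> (\<sigma> ^^ k) y \<in> ?U" for k
    by (rule funpow_eq_on_invariant[OF assms(3)])
      (use orbit_complement_invariant[OF assms(1,2)] in \<open>auto simp: \<tau>_def perm_restrict_def\<close>)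
  then have e: "(\<sigma> ^^ k) y = (\<tau> ^^ k) y" for k
    by simp
  show "cyc_orbit \<sigma> y = cyc_orbit \<tau> y"
    unfolding cyc_orbit_def e ..
  show "cyc_prod F \<sigma> y = cyc_prod F \<tau> y"
    unfolding cyc_prod_def cyc_len_def e ..
qed

text \<open>The cycle through \<open>x\<close> uses up \<open>length xs + 1\<close> points and one
  head, hence contributes \<open>length xs\<close> to the sign exponent; the other cycles are those
  of the restriction, with the same heads.\<close>

lemma signed_term_split_cycle:
  assumes T: "finite T" "x \<in> T" and s: "\<sigma> permutes T"
  defines "\<tau> \<equiv> perm_restrict (T - set (support \<sigma> x)) \<sigma>"
    and "xs \<equiv> tl (support \<sigma> x)"
    and "hs \<equiv> x # sorted_list_of_set {y \<in> T. y \<notin> cyc_orbit \<sigma> x \<and> y = Min (cyc_orbit \<sigma> y)}"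
  shows "(- 1) ^ (card T - length hs) * prod_list (map (cyc_prod F \<sigma>) hs)
    = (- 1) ^ length xs * walk F (F x) xs x * perm_term F (T - set (x # xs)) \<tau>"
proof -
  have p: "permutation \<sigma>" using T(1) s by (rule finite_permutation)
  have sup: "support \<sigma> x = x # xs"
    using support_eq_Cons[OF p, of x] by (simp add: xs_def)
  let ?U = "T - set (x # xs)"
  have orb: "cyc_orbit \<sigma> x = set (x # xs)"
    using cyc_orbit_eq_support[OF p, of x] sup by simp
  have \<tau>: "\<tau> = perm_restrict ?U \<sigma>"
    by (simp only: \<tau>_def sup)
  have oeq: "cyc_orbit \<sigma> y = cyc_orbit \<tau> y" "cyc_prod F \<sigma> y = cyc_prod F \<tau> y" if "y \<in> ?U" for y
    using restrict_orbit_eq(1)[OF T(1) s, of y x] restrict_orbit_eq(2)[OF T(1) s, of y x F] that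
    by (simp_all only: \<tau> sup)
  have hd: "{y \<in> T. y \<notin> cyc_orbit \<sigma> x \<and> y = Min (cyc_orbit \<sigma> y)} = cyc_heads ?U \<tau>"
    unfolding cyc_heads_def orb using oeq(1) by auto
  define ls where "ls = sorted_list_of_set (cyc_heads ?U \<tau>)"
  have fin: "finite (cyc_heads ?U \<tau>)"
    using T(1) by (simp add: cyc_heads_def)
  have setls: "set ls \<subseteq> ?U"
    unfolding ls_def using fin by (auto simp: cyc_heads_def)
  \<comment> \<open>The exponents are truncated differences; they split because there are at most as
    many heads as points.\<close>
  have lenls: "length ls \<le> card ?U"
    using T(1) card_mono[OF _ setls] distinct_card[of ls] by (simp add: ls_def)
  have hs: "hs = x # ls"
    unfolding hs_def hd ls_def ..
  have "distinct (x # xs)"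
    using cycle_of_permutation[OF p, of x] sup by simp
  then have cdx: "card (set (x # xs)) = Suc (length xs)"
    by (metis distinct_card length_Cons)
  have "set (x # xs) \<subseteq> T"
    using support_subset[OF T(1) s T(2)] sup by simp
  then have cd: "card T = Suc (length xs) + card ?U"
    using cdx card_Diff_subset[OF finite_set, of "x # xs" T] card_mono[OF T(1), of "set (x # xs)"]
    by linarith
  have ex: "card T - length hs = length xs + (card ?U - length ls)"
    using lenls by (simp add: cd hs)
  have mp: "map (cyc_prod F \<sigma>) ls = map (cyc_prod F \<tau>) ls"
    using setls oeq(2) by (intro map_cong) auto
  have "(- 1) ^ (card T - length hs) * prod_list (map (cyc_prod F \<sigma>) hs) =
      (- 1) ^ length xs * ((- 1) ^ (card ?U - length ls) * walk F (F x) xs x)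
         * prod_list (map (cyc_prod F \<tau>) ls)"
    unfolding ex unfolding hs list.map prod_list.Cons mp power_add
      cyc_prod_eq_walk[OF p, of F x] xs_def[symmetric]
    by (simp only: mult.assoc)
  also have "\<dots> = (- 1) ^ length xs * walk F (F x) xs x * perm_term F ?U \<tau>"
    unfolding perm_term_def ls_def[symmetric] Let_def
    by (subst minus_one_power_central) (simp only: mult.assoc)
  finally show ?thesis .
qed

text \<open>Common source of two expansions: of \<open>rdet\<close>, where \<open>x\<close> is the
  prescribed row, and of \<open>gdet\<close>, where \<open>x\<close> is the least index.\<close>

lemma sum_signed_terms_eq_walk_sum:
  assumes "finite T" "x \<in> T"
  shows "(\<Sum>\<sigma> | \<sigma> permutes T.
      let hs = x # sorted_list_of_set {y \<in> T. y \<notin> cyc_orbit \<sigma> x \<and> y = Min (cyc_orbit \<sigma> y)} in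
        (- 1) ^ (card T - length hs) * prod_list (map (cyc_prod F \<sigma>) hs))
    = walk_sum F (T - {x}) (F x) x"
proof -
  define f where "f = (\<lambda>xs \<tau>. (- 1) ^ length xs * walk F (F x) xs x
    * perm_term F (T - set (x # xs)) \<tau>)"
  have "(\<Sum>\<sigma> | \<sigma> permutes T.
      let hs = x # sorted_list_of_set {y \<in> T. y \<notin> cyc_orbit \<sigma> x \<and> y = Min (cyc_orbit \<sigma> y)} in
        (- 1) ^ (card T - length hs) * prod_list (map (cyc_prod F \<sigma>) hs))
    = (\<Sum>\<sigma> | \<sigma> permutes T.
        f (tl (support \<sigma> x)) (perm_restrict (T - set (support \<sigma> x)) \<sigma>))"
  proof (rule sum.cong[OF refl])
    fix \<sigma> assume "\<sigma> \<in> {\<sigma>. \<sigma> permutes T}"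
    then have s: "\<sigma> permutes T" by simp
    show "(let hs = x # sorted_list_of_set {y \<in> T. y \<notin> cyc_orbit \<sigma> x \<and> y = Min (cyc_orbit \<sigma> y)} in
        (- 1) ^ (card T - length hs) * prod_list (map (cyc_prod F \<sigma>) hs)) =
        f (tl (support \<sigma> x)) (perm_restrict (T - set (support \<sigma> x)) \<sigma>)"
      unfolding Let_def f_def by (rule signed_term_split_cycle[OF assms s])
  qed
  also have "\<dots> = (\<Sum>xs\<in>distinct_lists (T - {x}). \<Sum>\<tau> | \<tau> permutes (T - set (x # xs)).
      f xs \<tau>)"
    by (rule sum_permutes_split_cycle[OF assms, of f])
  also have "\<dots> = walk_sum F (T - {x}) (F x) x"
  proof -
    have "T - {x} - set xs = T - set (x # xs)" for xs by auto
    then show ?thesis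
      unfolding walk_sum_def gdet_def f_def by (simp only: sum_distrib_left)
  qed
  finally show ?thesis .
qed

lemma rdet_eq_walk_sum:
  assumes "i < n"
  shows "rdet n i F = walk_sum F ({..<n} - {i}) (F i) i"
proof -
  have "i \<in> {..<n}" using assms by simp
  from sum_signed_terms_eq_walk_sum[OF finite_lessThan this, of F] show ?thesis
    by (simp only: rdet_def other_cyc_heads_def card_lessThan lessThan_iff)
qed

lemma self_in_cyc_orbit: "y \<in> cyc_orbit \<sigma> y"
  unfolding cyc_orbit_def by (rule CollectI, rule exI[of _ 0]) simp

text \<open>The least index heads its own cycle and comes first in the sorted list of heads. The
  right side involves determinants of proper subsets only, so this is the recursion for inductions
  on \<open>T\<close>.\<close>

lemma gdet_eq_walk_sum_Min:
  assumes T: "finite T" "T \<noteq> {}"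
  shows "gdet F T = walk_sum F (T - {Min T}) (F (Min T)) (Min T)"
proof -
  let ?x = "Min T"
  have x: "?x \<in> T" using T by simp
  have "sorted_list_of_set (cyc_heads T \<sigma>) = ?x # sorted_list_of_set
      {y \<in> T. y \<notin> cyc_orbit \<sigma> ?x \<and> y = Min (cyc_orbit \<sigma> y)}" (is "_ = _ # sorted_list_of_set ?O")
    if s: "\<sigma> permutes T" for \<sigma>
  proof -
    have p: "permutation \<sigma>" using T(1) s by (rule finite_permutation)
    have sub: "cyc_orbit \<sigma> y \<subseteq> T" if "y \<in> T" for y
      unfolding cyc_orbit_eq_support[OF p] using support_subset[OF T(1) s that] .
    have Mo: "Min (cyc_orbit \<sigma> y) = ?x" if "y \<in> T" "?x \<in> cyc_orbit \<sigma> y" for y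
      using sub[OF that(1)] that T(1) by (intro Min_eqI) (auto intro: finite_subset)
    have dis: "cyc_orbit \<sigma> y = cyc_orbit \<sigma> ?x" if "y \<in> cyc_orbit \<sigma> ?x" for y
      using disjoint_support[OF p] self_in_cyc_orbit[of y \<sigma>] that
      unfolding disjoint_def cyc_orbit_eq_support[OF p] by blast
    have hd: "cyc_heads T \<sigma> = insert ?x ?O"
    proof
      show "cyc_heads T \<sigma> \<subseteq> insert ?x ?O"
      proof
        fix y assume y: "y \<in> cyc_heads T \<sigma>"
        then have yT: "y \<in> T" and ym: "y = Min (cyc_orbit \<sigma> y)"
          by (auto simp: cyc_heads_def)
        show "y \<in> insert ?x ?O"
        proof (cases "y \<in> cyc_orbit \<sigma> ?x")
          case True
          then have "?x \<in> cyc_orbit \<sigma> y"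
            using dis self_in_cyc_orbit by blast
          then show ?thesis using Mo yT ym by simp
        qed (use yT ym in simp)
      qed
      show "insert ?x ?O \<subseteq> cyc_heads T \<sigma>"
        using Mo[OF x self_in_cyc_orbit] x by (auto simp: cyc_heads_def)
    qed
    have "?x \<notin> ?O" using self_in_cyc_orbit by blast
    moreover have "finite ?O" using T(1) by simp
    moreover have "\<forall>y\<in>?O. ?x \<le> y" using T by simp
    ultimately have "sorted_list_of_set (insert ?x ?O) = ?x # sorted_list_of_set ?O"
      by (simp add: sorted_list_of_set_insert insort_is_Cons)
    then show ?thesis using hd by simp
  qed
  then have "gdet F T = (\<Sum>\<sigma> | \<sigma> permutes T.
      let hs = ?x # sorted_list_of_set {y \<in> T. y \<notin> cyc_orbit \<sigma> ?x \<and> y = Min (cyc_orbit \<sigma> y)} in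
        (- 1) ^ (card T - length hs) * prod_list (map (cyc_prod F \<sigma>) hs))"
    unfolding gdet_def perm_term_def by (intro sum.cong refl) simp
  then show ?thesis
    using sum_signed_terms_eq_walk_sum[OF T(1) x] by simp
qed

section \<open>Renumbering the indices\<close>

lemma distinct_lists_image:
  assumes "inj_on e T"
  shows "bij_betw (map e) (distinct_lists T) (distinct_lists (e ` T))"
proof (rule bij_betw_imageI)
  show "inj_on (map e) (distinct_lists T)"
  proof (rule inj_onI)
    fix xs ys assume "xs \<in> distinct_lists T" "ys \<in> distinct_lists T" "map e xs = map e ys"
    then show "xs = ys"
      using assms by (intro map_inj_on[of e xs ys]) (auto simp: distinct_lists_def intro: inj_on_subset)
  qed
  show "map e ` distinct_lists T = distinct_lists (e ` T)"
  proof (intro equalityI subsetI)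
    fix ys assume "ys \<in> map e ` distinct_lists T"
    then obtain xs where xs: "ys = map e xs" "distinct xs" "set xs \<subseteq> T"
      by (auto simp: distinct_lists_def)
    then show "ys \<in> distinct_lists (e ` T)"
      using image_mono[OF xs(3), of e] inj_on_subset[OF assms xs(3)]
      by (simp add: distinct_lists_def distinct_map)
  next
    fix ys assume ys: "ys \<in> distinct_lists (e ` T)"
    let ?g = "inv_into T e"
    have "map e (map ?g ys) = ys"
      using ys by (auto intro!: map_idI simp: distinct_lists_def f_inv_into_f subset_iff)
    moreover have "map ?g ys \<in> distinct_lists T"
      using ys by (auto simp: distinct_lists_def distinct_map subset_iff inv_into_into
        intro!: inj_on_subset[OF inj_on_inv_into[of _ e T]])
    ultimately show "ys \<in> map e ` distinct_lists T"
      by (metis imageI)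
  qed
qed

lemma walk_map:
  assumes "\<And>a b. a \<in> T \<Longrightarrow> b \<in> insert j T \<Longrightarrow> F a b = G (e a) (e b)"
    and "\<And>b. b \<in> insert j T \<Longrightarrow> v b = w (e b)" and "set xs \<subseteq> T"
  shows "walk F v xs j = walk G w (map e xs) (e j)"
  using assms(2,3)
proof (induct xs arbitrary: v w)
  case (Cons x xs)
  have "walk F (F x) xs j = walk G (G (e x)) (map e xs) (e j)"
    by (rule Cons(1)) (use assms(1) Cons(3) in auto)
  then show ?case using Cons(2,3) by simp
qed simp

lemma walk_sum_map:
  assumes "inj_on e T"
    and "\<And>a b. a \<in> T \<Longrightarrow> b \<in> insert j T \<Longrightarrow> F a b = G (e a) (e b)"
    and "\<And>b. b \<in> insert j T \<Longrightarrow> v b = w (e b)"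
    and "\<And>U. U \<subseteq> T \<Longrightarrow> gdet F U = gdet G (e ` U)"
  shows "walk_sum F T v j = walk_sum G (e ` T) w (e j)"
proof -
  have "(\<Sum>xs\<in>distinct_lists T. (- 1) ^ length xs * walk F v xs j * gdet F (T - set xs)) =
    (\<Sum>xs\<in>distinct_lists T. (- 1) ^ length (map e xs) * walk G w (map e xs) (e j)
       * gdet G (e ` T - set (map e xs)))" (is "_ = (\<Sum>xs\<in>_. ?g (map e xs))")
  proof (rule sum.cong[OF refl])
    fix xs assume "xs \<in> distinct_lists T"
    then have xs: "set xs \<subseteq> T" by (simp add: distinct_lists_def)
    have "walk F v xs j = walk G w (map e xs) (e j)"
      by (rule walk_map[where F = F and G = G and v = v and w = w and j = j, OF assms(2,3) xs])
    moreover have "e ` T - set (map e xs) = e ` (T - set xs)"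
      using xs by (simp add: inj_on_image_set_diff[OF assms(1)])
    ultimately show "(- 1) ^ length xs * walk F v xs j * gdet F (T - set xs) =
       (- 1) ^ length (map e xs) * walk G w (map e xs) (e j) * gdet G (e ` T - set (map e xs))"
      using assms(4)[of "T - set xs"] by simp
  qed
  also have "\<dots> = sum ?g (distinct_lists (e ` T))"
    by (rule sum.reindex_bij_betw[OF distinct_lists_image[OF assms(1)]])
  finally show ?thesis
    unfolding walk_sum_def .
qed

text \<open>Cycles are read from their least elements, and an order-preserving \<open>e\<close> maps
  least elements to least elements. Hence the recursion at the least index can be transported, with
  smaller sets handled by induction.\<close>

lemma gdet_map:
  assumes "finite T" "strict_mono_on T e"
    and "\<And>a b. a \<in> T \<Longrightarrow> b \<in> T \<Longrightarrow> F a b = G (e a) (e b)"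
  shows "gdet F T = gdet G (e ` T)"
  using assms
proof (induct T rule: finite_psubset_induct)
  case (psubset T)
  show ?case
  proof (cases "T = {}")
    case False
    let ?x = "Min T"
    have x: "?x \<in> T" using False psubset(1) by simp
    have inj: "inj_on e T" using psubset(3) by (rule strict_mono_on_imp_inj_on)
    have "Min (e ` T) = e ?x"
      using x psubset(1) by (intro Min_eqI) (auto intro!: strict_mono_on_leD[OF psubset(3)])
    moreover have "e ` T - {e ?x} = e ` (T - {?x})"
      using x inj by (auto simp: inj_on_eq_iff)
    moreover have "walk_sum F (T - {?x}) (F ?x) ?x = walk_sum G (e ` (T - {?x})) (G (e ?x)) (e ?x)"
    proof (rule walk_sum_map[where e = e])
      show "inj_on e (T - {?x})" using inj by (rule inj_on_subset) auto
      show "gdet F U = gdet G (e ` U)" if "U \<subseteq> T - {?x}" for U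
      proof (rule psubset(2))
        show "U \<subset> T" using that x by auto
        then show "strict_mono_on U e" using psubset(3)
          by (meson monotone_on_subset psubset_imp_subset)
      qed (use psubset(4) that in auto)
    qed (use psubset(4) x in auto)
    ultimately show ?thesis
      using gdet_eq_walk_sum_Min[of T F] gdet_eq_walk_sum_Min[of "e ` T" G] psubset(1) False by simp
  qed simp
qed

lemma hdet_eq_gdet: "hdet n F = gdet F {..<n}"
proof (cases "n = 0")
  case False
  then have "Min {..<n} = 0" by (intro Min_eqI) auto
  then show ?thesis
    using False gdet_eq_walk_sum_Min[of "{..<n}" F] by (simp add: hdet_def rdet_eq_walk_sum lessThan_empty_iff)
qed (simp add: hdet_def)

lemma sorted_list_of_set_strict_mono:
  assumes "finite \<alpha>"
  shows "strict_mono_on {..<card \<alpha>} ((!) (sorted_list_of_set \<alpha>))"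
    and "(!) (sorted_list_of_set \<alpha>) ` {..<card \<alpha>} = \<alpha>"
proof -
  show "strict_mono_on {..<card \<alpha>} ((!) (sorted_list_of_set \<alpha>))"
    by (rule strict_mono_onI) (simp add: sorted_wrt_nth_less[OF strict_sorted_list_of_set])
  show "(!) (sorted_list_of_set \<alpha>) ` {..<card \<alpha>} = \<alpha>"
    using assms by (metis atLeast0LessThan length_sorted_list_of_set list.set_map map_nth set_sorted_list_of_set set_upt)
qed

lemma hdet_sub_eq_gdet:
  assumes "finite \<alpha>"
  shows "hdet_sub \<alpha> G = gdet G \<alpha>"
  using gdet_map[of "{..<card \<alpha>}" "(!) (sorted_list_of_set \<alpha>)" "psub \<alpha> G" G]
    sorted_list_of_set_strict_mono[OF assms]
  by (simp add: hdet_sub_def hdet_eq_gdet psub_def)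

lemma rdet_sub_eq_walk_sum:
  assumes \<alpha>: "finite \<alpha>" "j \<in> \<alpha>"
  shows "rdet_sub j \<alpha> G = walk_sum G (\<alpha> - {j}) (G j) j"
proof -
  let ?e = "(!) (sorted_list_of_set \<alpha>)" and ?n = "card \<alpha>"
  note sm = sorted_list_of_set_strict_mono[OF \<alpha>(1)]
  have inj: "inj_on ?e {..<?n}" using sm(1) by (rule strict_mono_on_imp_inj_on)
  obtain p where p: "p < ?n" "?e p = j" using sm(2) \<alpha>(2) by (metis imageE lessThan_iff)
  \<comment> \<open>The 0-based position \<open>p\<close> of \<open>j\<close> in the sorted list is
    the number of elements of \<alpha> below \<open>j\<close>, which is the row that
    \<open>rdet_sub\<close> uses.\<close>
  have "{x \<in> \<alpha>. x < j} = ?e ` {..<p}"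
  proof (intro equalityI subsetI)
    fix x assume x: "x \<in> {x \<in> \<alpha>. x < j}"
    then obtain k where k: "k < ?n" "x = ?e k" using sm(2) by (metis (no_types, lifting) imageE lessThan_iff mem_Collect_eq)
    have "k < p"
      using x k p strict_mono_on_less[OF sm(1), of k p] by simp
    then show "x \<in> ?e ` {..<p}" using k by simp
  next
    fix x assume "x \<in> ?e ` {..<p}"
    then obtain k where k: "k < p" "x = ?e k" by auto
    then have "x < j" using p strict_mono_onD[OF sm(1), of k p] by simp
    moreover have "x \<in> \<alpha>" using sm(2) k p by (metis imageI lessThan_iff order.strict_trans)
    ultimately show "x \<in> {x \<in> \<alpha>. x < j}" by simp
  qed
  then have cp: "card {x \<in> \<alpha>. x < j} = p"
    using inj p by (metis card_image card_lessThan inj_on_subset lessThan_subset_iff less_imp_le)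
  have im: "?e ` ({..<?n} - {p}) = \<alpha> - {j}"
    using sm(2) p inj_on_image_set_diff[OF inj, of "{..<?n}" "{p}"] by simp
  have "rdet_sub j \<alpha> G = walk_sum (psub \<alpha> G) ({..<?n} - {p}) (psub \<alpha> G p) p"
    unfolding rdet_sub_def cp by (rule rdet_eq_walk_sum[OF p(1)])
  also have "\<dots> = walk_sum G (?e ` ({..<?n} - {p})) (G (?e p)) (?e p)"
  proof (rule walk_sum_map[where e = ?e])
    show "inj_on ?e ({..<?n} - {p})" using inj by (rule inj_on_subset) auto
    show "gdet (psub \<alpha> G) U = gdet G (?e ` U)" if "U \<subseteq> {..<?n} - {p}" for U
    proof (rule gdet_map[where e = ?e])
      show "finite U" using that finite_subset by blast
      show "strict_mono_on U ?e" using sm(1) that by (meson Diff_subset monotone_on_subset order_trans)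
    qed (use that in \<open>auto simp: psub_def\<close>)
  qed (use p in \<open>auto simp: psub_def\<close>)
  finally show ?thesis unfolding im p(2) .
qed

text \<open>A walk from \<open>j\<close> reads row \<open>j\<close> at its first step only, and the
  other cycles avoid \<open>j\<close>; every factor but the first comes from
  \<open>G\<close>.\<close>

lemma rdet_sub_row_repl:
  assumes \<alpha>: "finite \<alpha>" "j \<in> \<alpha>"
  shows "rdet_sub j \<alpha> (row_repl G j v) = walk_sum G (\<alpha> - {j}) v j"
proof -
  have "walk_sum (row_repl G j v) (\<alpha> - {j}) v j = walk_sum G (id ` (\<alpha> - {j})) v (id j)"
  proof (rule walk_sum_map[where e = id])
    show "gdet (row_repl G j v) U = gdet G (id ` U)" if "U \<subseteq> \<alpha> - {j}" for U
    proof (rule gdet_map[where e = id])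
      show "finite U" using that \<alpha>(1) finite_subset by blast
      show "strict_mono_on U id" by (simp add: monotone_on_def)
    qed (use that in \<open>auto simp: row_repl_def\<close>)
  qed (auto simp: row_repl_def)
  then show ?thesis
    using rdet_sub_eq_walk_sum[OF \<alpha>, of "row_repl G j v"] by (simp add: row_repl_def)
qed

section \<open>Determinants of Hermitian matrices\<close>

lemma minus_one_power_left_commute: "(x :: 'a :: ring_1) * ((- 1) ^ n * y) = (- 1) ^ n * (x * y)"
  by (induct n) simp_all

lemma walk_append: "walk F v (as @ i # bs) j = walk F v as i * walk F (F i) bs j"
  by (induct as arbitrary: v) (simp_all add: mult.assoc)

lemma walk_cong:
  "(\<And>k. k \<in> insert j (set xs) \<Longrightarrow> v k = w k) \<Longrightarrow> walk F v xs j = walk F w xs j"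
  by (cases xs) auto

lemma walk_add: "walk F (\<lambda>k. v k + w k) xs j = walk F v xs j + walk F w xs j"
  by (cases xs) (simp_all add: distrib_right)

lemma walk_scale: "walk F (\<lambda>k. c * v k) xs j = c * walk F v xs j"
  by (cases xs) (simp_all add: mult.assoc)

text \<open>Conjugation reverses the product and, \<open>F\<close> being Hermitian, swaps the
  indices of each factor: the walk is traversed backwards.\<close>

lemma walk_rev:
  assumes "qadj F = F"
  shows "qcnj (walk F (F i) xs j) = walk F (F j) (rev xs) i"
proof -
  have h: "qcnj (F a b) = F b a" for a b
    using fun_cong[OF fun_cong[OF assms]] by (metis qadj_def)
  show ?thesis
    by (induct xs arbitrary: i) (simp_all add: walk_append h)
qed

lemma walk_sum_cong:
  assumes "\<And>k. k \<in> insert j T \<Longrightarrow> v k = w k"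
  shows "walk_sum F T v j = walk_sum F T w j"
proof -
  have "walk F v xs j = walk F w xs j" if "xs \<in> distinct_lists T" for xs
    by (rule walk_cong) (use that assms in \<open>auto simp: distinct_lists_def\<close>)
  then show ?thesis by (simp add: walk_sum_def)
qed

lemma walk_sum_add: "walk_sum F T (\<lambda>k. v k + w k) j = walk_sum F T v j + walk_sum F T w j"
  by (simp add: walk_sum_def walk_add distrib_left distrib_right sum.distrib)

text \<open>Apart from the sign, which is central, the entry of the row is the leftmost factor of
  each term, so left coefficients come out.\<close>

lemma walk_sum_scale: "walk_sum F T (\<lambda>k. c * v k) j = c * walk_sum F T v j"
  unfolding walk_sum_def walk_scale sum_distrib_left
  by (simp only: mult.assoc minus_one_power_left_commute)

lemma walk_sum_zero: "walk_sum F T (\<lambda>k. 0) j = 0"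
  using walk_sum_scale[of F T 0 "\<lambda>k. 0" j] by simp

lemma walk_sum_linear:
  "walk_sum F T (\<lambda>k. \<Sum>l\<in>U. y l * G l k) j = (\<Sum>l\<in>U. y l * walk_sum F T (G l) j)"
  by (induct U rule: infinite_finite_induct)
    (simp_all add: walk_sum_zero walk_sum_add walk_sum_scale)

section \<open>Recursions for walk sums\<close>

lemma distinct_lists_eq:
  "distinct_lists T = insert [] ((\<lambda>(k, ys). k # ys) ` (SIGMA k:T. distinct_lists (T - {k})))"
proof (intro equalityI subsetI)
  fix xs assume "xs \<in> distinct_lists T"
  then show "xs \<in> insert [] ((\<lambda>(k, ys). k # ys) ` (SIGMA k:T. distinct_lists (T - {k})))"
    by (cases xs) (auto simp: distinct_lists_def image_iff)
qed (auto simp: distinct_lists_def)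

text \<open>Walks are sorted by their first step. A direct step to \<open>j\<close> leaves all of
  \<open>T\<close> to the determinant; a step to \<open>k\<close> continues with row
  \<open>k\<close> on \<open>T - {k}\<close>, and the additional entry changes the sign.\<close>

lemma walk_sum_step:
  assumes "finite T"
  shows "walk_sum F T v j = v j * gdet F T - (\<Sum>k\<in>T. v k * walk_sum F (T - {k}) (F k) j)"
proof -
  let ?g = "\<lambda>xs. (- 1) ^ length xs * walk F v xs j * gdet F (T - set xs)"
  let ?S = "SIGMA k:T. distinct_lists (T - {k})"
  have fin: "finite ?S" using assms by auto
  have "walk_sum F T v j = ?g [] + sum ?g ((\<lambda>(k, ys). k # ys) ` ?S)"
    unfolding walk_sum_def by (subst distinct_lists_eq, subst sum.insert) (use fin in auto)
  also have "sum ?g ((\<lambda>(k, ys). k # ys) ` ?S) = (\<Sum>(k, ys)\<in>?S. ?g (k # ys))"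
    by (subst sum.reindex) (auto simp: inj_on_def o_def case_prod_beta)
  also have "\<dots> = (\<Sum>k\<in>T. \<Sum>ys\<in>distinct_lists (T - {k}). ?g (k # ys))"
    using assms by (subst sum.Sigma) auto
  also have "\<dots> = (\<Sum>k\<in>T. - (v k * walk_sum F (T - {k}) (F k) j))"
  proof (rule sum.cong[OF refl])
    fix k
    have "T - {k} - set ys = T - set (k # ys)" for ys by auto
    then show "(\<Sum>ys\<in>distinct_lists (T - {k}). ?g (k # ys)) = - (v k * walk_sum F (T - {k}) (F k) j)"
      unfolding walk_sum_def sum_distrib_left sum_negf[symmetric]
      by (simp add: mult.assoc minus_one_power_left_commute)
  qed
  finally show ?thesis by (simp add: sum_negf)
qed

lemma walk_sum_supported:
  assumes "finite T" "\<And>k. k \<in> T \<Longrightarrow> v k = 0"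
  shows "walk_sum F T v j = v j * gdet F T"
  by (subst walk_sum_step) (use assms in simp_all)

text \<open>Reversal is an involution of \<open>distinct_lists T\<close>. Reality is asked of
  determinants on subsets of \<open>T\<close> only, so that the lemma applies inside the induction
  that proves reality.\<close>

lemma walk_sum_qcnj:
  assumes F: "qadj F = F" and D: "\<And>U. U \<subseteq> T \<Longrightarrow> qcnj (gdet F U) = gdet F U"
  shows "qcnj (walk_sum F T (F i) j) = walk_sum F T (F j) i"
proof -
  have "qcnj (walk_sum F T (F i) j) = (\<Sum>xs\<in>distinct_lists T.
      (- 1) ^ length (rev xs) * walk F (F j) (rev xs) i * gdet F (T - set (rev xs)))"
    unfolding walk_sum_def qcnj_sum
  proof (rule sum.cong[OF refl])
    fix xs
    have g: "qcnj (gdet F (T - set xs)) = gdet F (T - set xs)" by (rule D) auto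
    show "qcnj ((- 1) ^ length xs * walk F (F i) xs j * gdet F (T - set xs)) =
       (- 1) ^ length (rev xs) * walk F (F j) (rev xs) i * gdet F (T - set (rev xs))"
      using qcnj_fixed_central[OF g, of "walk F (F j) (rev xs) i * (- 1) ^ length xs"]
      by (simp add: g walk_rev[OF F] minus_one_power_central)
  qed
  also have "\<dots> = walk_sum F T (F j) i"
    unfolding walk_sum_def
    by (rule sum.reindex_bij_witness[where i = rev and j = rev]) (auto simp: distinct_lists_def)
  finally show ?thesis .
qed

lemma distinct_lists_insert:
  assumes "i \<notin> T"
  shows "distinct_lists (insert i T) = distinct_lists T \<union>
    (\<lambda>(as, bs). as @ i # bs) ` (SIGMA as:distinct_lists T. distinct_lists (T - set as))"
    (is "_ = _ \<union> ?g ` ?S")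
proof (intro equalityI subsetI)
  fix xs assume xs: "xs \<in> distinct_lists (insert i T)"
  show "xs \<in> distinct_lists T \<union> ?g ` ?S"
  proof (cases "i \<in> set xs")
    case True
    then obtain as bs where e: "xs = as @ i # bs"
      by (metis split_list)
    then have "(as, bs) \<in> ?S"
      using xs by (auto simp: distinct_lists_def)
    then show ?thesis using e by (intro UnI2 image_eqI[of _ _ "(as, bs)"]) simp_all
  qed (use xs in \<open>auto simp: distinct_lists_def\<close>)
next
  fix xs assume "xs \<in> distinct_lists T \<union> ?g ` ?S"
  then show "xs \<in> distinct_lists (insert i T)"
    using assms by (auto simp: distinct_lists_def)
qed

text \<open>Walks are sorted by whether they visit \<open>i\<close>. If not, \<open>i\<close> stays
  in the determinant; otherwise the walk is cut at \<open>i\<close> into a walk to \<open>i\<close>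
  and a disjoint one from \<open>i\<close> to \<open>j\<close>, and the entry \<open>i\<close>
  itself accounts for the minus sign.\<close>

lemma walk_sum_insert:
  assumes "finite T" "i \<notin> T"
  shows "walk_sum F (insert i T) v j =
     (\<Sum>xs\<in>distinct_lists T. (- 1) ^ length xs * walk F v xs j * gdet F (insert i (T - set xs)))
   - (\<Sum>xs\<in>distinct_lists T. (- 1) ^ length xs * walk F v xs i * walk_sum F (T - set xs) (F i) j)"
proof -
  let ?g = "\<lambda>xs. (- 1) ^ length xs * walk F v xs j * gdet F (insert i T - set xs)"
  let ?c = "\<lambda>(as, bs). as @ i # bs"
  let ?S = "SIGMA as:distinct_lists T. distinct_lists (T - set as)"
  have fin: "finite ?S" using assms(1) by auto
  have inj: "inj_on ?c ?S"
  proof (rule inj_onI)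
    fix p q assume "p \<in> ?S" "q \<in> ?S" "?c p = ?c q"
    moreover have "i \<notin> set (fst p)" "i \<notin> set (snd p)"
      using \<open>p \<in> ?S\<close> assms(2) by (auto simp: distinct_lists_def)
    ultimately show "p = q"
      using append_Cons_eq_iff[of i "fst p" "snd p" "fst q" "snd q"]
      by (auto simp: case_prod_unfold prod_eq_iff)
  qed
  have "walk_sum F (insert i T) v j = sum ?g (distinct_lists T) + sum ?g (?c ` ?S)"
    unfolding walk_sum_def distinct_lists_insert[OF assms(2)]
  proof (rule sum.union_disjoint)
    show "distinct_lists T \<inter> ?c ` ?S = {}"
      using assms(2) by (auto simp: distinct_lists_def)
  qed (use fin assms(1) in simp_all)
  also have "sum ?g (distinct_lists T) =
      (\<Sum>xs\<in>distinct_lists T. (- 1) ^ length xs * walk F v xs j * gdet F (insert i (T - set xs)))"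
  proof (rule sum.cong[OF refl])
    fix xs assume "xs \<in> distinct_lists T"
    then have "insert i T - set xs = insert i (T - set xs)"
      using assms(2) by (auto simp: distinct_lists_def)
    then show "?g xs = (- 1) ^ length xs * walk F v xs j * gdet F (insert i (T - set xs))"
      by simp
  qed
  also have "sum ?g (?c ` ?S) = (\<Sum>(as, bs)\<in>?S. ?g (as @ i # bs))"
    by (subst sum.reindex[OF inj]) (simp only: o_def case_prod_unfold)
  also have "\<dots> = (\<Sum>as\<in>distinct_lists T. \<Sum>bs\<in>distinct_lists (T - set as). ?g (as @ i # bs))"
    using assms by (subst sum.Sigma) auto
  also have "\<dots> = (\<Sum>as\<in>distinct_lists T.
      - ((- 1) ^ length as * walk F v as i * walk_sum F (T - set as) (F i) j))"
  proof (rule sum.cong[OF refl])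
    fix as
    have "insert i T - set (as @ i # bs) = T - set as - set bs" for bs
      using assms(2) by auto
    then show "(\<Sum>bs\<in>distinct_lists (T - set as). ?g (as @ i # bs)) =
      - ((- 1) ^ length as * walk F v as i * walk_sum F (T - set as) (F i) j)"
      unfolding walk_sum_def sum_distrib_left sum_negf[symmetric]
    proof (intro sum.cong refl)
      fix bs :: "nat list"
      have "(- 1) ^ length (as @ i # bs) = - ((- 1) ^ length as * (- 1) ^ length bs :: quat)"
        by (simp add: power_add)
      then show "?g (as @ i # bs) = - ((- 1) ^ length as * walk F v as i *
         ((- 1) ^ length bs * walk F (F i) bs j * gdet F (T - set as - set bs)))"
        using \<open>insert i T - set (as @ i # bs) = T - set as - set bs\<close>
          minus_one_power_central[of "length bs" "walk F v as i"]
        by (simp only: walk_append) (simp add: mult.assoc[symmetric], simp add: mult.assoc)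
    qed
  qed
  finally show ?thesis by (simp add: sum_negf)
qed

lemma sum_distinct_lists_swap:
  assumes "finite T"
  shows "(\<Sum>xs\<in>distinct_lists T. \<Sum>ys\<in>distinct_lists (T - set xs). f xs ys) =
    (\<Sum>ys\<in>distinct_lists T. \<Sum>xs\<in>distinct_lists (T - set ys). f xs ys)"
proof -
  let ?S = "SIGMA xs:distinct_lists T. distinct_lists (T - set xs)"
  have "(\<Sum>(xs, ys)\<in>?S. f xs ys) = (\<Sum>(ys, xs)\<in>?S. f xs ys)"
    by (rule sum.reindex_bij_witness[where i = "\<lambda>(a, b). (b, a)" and j = "\<lambda>(a, b). (b, a)"])
      (auto simp: distinct_lists_def)
  then show ?thesis
    using assms by (simp add: sum.Sigma)
qed

lemma Re_signed_mult_commute: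
  assumes "qcnj d = d"
  shows "Re ((- 1) ^ n * (p * q) * d) = Re ((- 1) ^ n * (q * p) * d)"
proof -
  have "qcnj (d * (- 1) ^ n) = d * (- 1) ^ n"
    using assms by (simp add: minus_one_power_central)
  moreover have "(- 1) ^ n * x * d = (d * (- 1) ^ n) * x" for x
    using qcnj_fixed_central[OF assms, of "(- 1) ^ n * x"] by (simp add: mult.assoc)
  ultimately show ?thesis
    by (simp add: Re_mult_fixed quat_Re_mult_commute[of p q])
qed

text \<open>Expanding along \<open>j\<close> and then along \<open>i\<close> leaves pairs of disjoint loops at \<open>j\<close> and \<open>i\<close>, and
  pairs of disjoint walks from \<open>j\<close> to \<open>i\<close> and back. Up to commuting factors, which real parts do not
  notice, this is symmetric in \<open>i\<close> and \<open>j\<close>.\<close>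

lemma Re_walk_sum_diagonal_swap:
  assumes T: "finite T" "i \<notin> T" "j \<notin> T"
    and D: "\<And>U. U \<subseteq> T \<Longrightarrow> qcnj (gdet F U) = gdet F U"
    and I: "\<And>U. U \<subseteq> T \<Longrightarrow> gdet F (insert i U) = walk_sum F U (F i) i"
    and J: "\<And>U. U \<subseteq> T \<Longrightarrow> gdet F (insert j U) = walk_sum F U (F j) j"
  shows "Re (walk_sum F (insert i T) (F j) j) = Re (walk_sum F (insert j T) (F i) i)"
proof -
  define t where "t p q xs ys = Re ((- 1) ^ (length xs + length ys) * (p * q) * gdet F (T - set xs - set ys))"
    for p q and xs ys :: "nat list"
  have t_swap: "t p q xs ys = t q p ys xs" for p q xs ys
  proof -
    have e: "T - set xs - set ys = T - set ys - set xs" by auto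
    have "qcnj (gdet F (T - set ys - set xs)) = gdet F (T - set ys - set xs)"
      by (rule D) auto
    then show ?thesis
      unfolding t_def e by (subst Re_signed_mult_commute) (simp_all add: add.commute)
  qed
  have ex: "Re ((- 1) ^ length xs * p * walk_sum F (T - set xs) w b) =
      (\<Sum>ys\<in>distinct_lists (T - set xs). t p (walk F w ys b) xs ys)" for xs p w b
  proof -
    have "(- 1) ^ length xs * p * ((- 1) ^ length ys * q * d)
        = (- 1) ^ (length xs + length ys) * (p * q) * d" for ys :: "nat list" and q d
      using minus_one_power_central[of "length ys" p]
      by (simp add: power_add mult.assoc) (simp add: mult.assoc[symmetric])
    then show ?thesis
      unfolding t_def by (simp add: walk_sum_def sum_distrib_left quat_Re_sum)
  qed
  have main: "Re (walk_sum F (insert b T) (F a) a) =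
     (\<Sum>xs\<in>distinct_lists T. \<Sum>ys\<in>distinct_lists (T - set xs).
        t (walk F (F a) xs a) (walk F (F b) ys b) xs ys)
   - (\<Sum>xs\<in>distinct_lists T. \<Sum>ys\<in>distinct_lists (T - set xs).
        t (walk F (F a) xs b) (walk F (F b) ys a) xs ys)"
    if b: "b \<notin> T" and B: "\<And>U. U \<subseteq> T \<Longrightarrow> gdet F (insert b U) = walk_sum F U (F b) b" for a b
  proof -
    have "gdet F (insert b (T - set xs)) = walk_sum F (T - set xs) (F b) b" for xs
      by (rule B) auto
    then show ?thesis
      by (simp add: walk_sum_insert[OF T(1) b] quat_Re_sum ex)
  qed
  have "Re (walk_sum F (insert i T) (F j) j) =
     (\<Sum>xs\<in>distinct_lists T. \<Sum>ys\<in>distinct_lists (T - set xs).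
        t (walk F (F i) ys i) (walk F (F j) xs j) ys xs)
   - (\<Sum>xs\<in>distinct_lists T. \<Sum>ys\<in>distinct_lists (T - set xs).
        t (walk F (F i) ys j) (walk F (F j) xs i) ys xs)"
    by (subst main[OF T(2) I], assumption) (intro arg_cong2[where f = "(-)"] sum.cong refl t_swap)
  also have "\<dots> = Re (walk_sum F (insert j T) (F i) i)"
    by (subst main[OF T(3) J], assumption)
      (intro arg_cong2[where f = "(-)"] sum_distinct_lists_swap[OF T(1), symmetric])
  finally show ?thesis .
qed

text \<open>Both claims are proved together by induction over proper subsets. Smaller determinants
  being real, the diagonal walk sums on \<open>S\<close> are real by reversal; the smaller diagonal
  identities feed \<open>Re_walk_sum_diagonal_swap\<close>, so the real parts for \<open>j\<close>
  and \<open>Min S\<close> agree.\<close>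

lemma gdet_hermitian:
  assumes F: "qadj F = F" and S: "finite S"
  shows "qcnj (gdet F S) = gdet F S \<and> (\<forall>j\<in>S. walk_sum F (S - {j}) (F j) j = gdet F S)"
  using S
proof (induct S rule: finite_psubset_induct)
  case (psubset S)
  show ?case
  proof (cases "S = {}")
    case False
    let ?i = "Min S"
    have i: "?i \<in> S" using False psubset(1) by simp
    have g: "gdet F S = walk_sum F (S - {?i}) (F ?i) ?i"
      using psubset(1) False by (rule gdet_eq_walk_sum_Min)
    have real: "qcnj (gdet F U) = gdet F U" if "U \<subset> S" for U
      using psubset(2)[OF that] by simp
    have real_diag: "qcnj (walk_sum F (S - {j}) (F j) j) = walk_sum F (S - {j}) (F j) j" if "j \<in> S" for j
      by (rule walk_sum_qcnj[OF F]) (use that in \<open>auto intro: real\<close>)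
    have "walk_sum F (S - {j}) (F j) j = gdet F S" if j: "j \<in> S" for j
    proof (cases "j = ?i")
      case False
      let ?T = "S - {?i, j}"
      have e: "S - {j} = insert ?i ?T" "S - {?i} = insert j ?T"
        using False i j by auto
      have ins: "gdet F (insert k U) = walk_sum F U (F k) k"
        if "U \<subseteq> ?T" "k \<in> {?i, j}" for U k
      proof -
        have "insert k U \<subset> S" using that i j False by auto
        from psubset(2)[OF this] have "walk_sum F (insert k U - {k}) (F k) k = gdet F (insert k U)"
          by simp
        moreover have "insert k U - {k} = U" using that by auto
        ultimately show ?thesis by simp
      qed
      have "Re (walk_sum F (insert ?i ?T) (F j) j) = Re (walk_sum F (insert j ?T) (F ?i) ?i)"
      proof (rule Re_walk_sum_diagonal_swap)
        show "qcnj (gdet F U) = gdet F U" if "U \<subseteq> ?T" for U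
          by (rule real) (use that i in auto)
      qed (use psubset(1) ins in simp_all)
      then show ?thesis
        using qcnj_fixed_eqI[OF real_diag[OF j] real_diag[OF i]] by (simp only: g e)
    qed (simp add: g)
    then show ?thesis using g real_diag[OF i] by simp
  qed simp
qed

lemmas gdet_real = gdet_hermitian[THEN conjunct1]

lemma walk_sum_diagonal:
  assumes "qadj F = F" "finite S" "j \<in> S"
  shows "walk_sum F (S - {j}) (F j) j = gdet F S"
  using gdet_hermitian[OF assms(1,2)] assms(3) by blast

text \<open>The analogue of a determinant with two equal rows. A walk from \<open>k\<close> to \<open>j\<close> together with a
  disjoint loop at \<open>k\<close> arises twice, with opposite signs and with the two factors in either order;
  summed over all loops, the loop factor is a real number, and so the terms cancel.\<close>

lemma walk_sum_off_diagonal: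
  assumes F: "qadj F = F" and T: "finite T" "k \<in> T"
  shows "walk_sum F T (F k) j = 0"
proof -
  let ?U = "T - {k}"
  have U: "finite ?U" "k \<notin> ?U" "T = insert k ?U" using T by auto
  let ?w = "\<lambda>xs. walk F (F k) xs j" and ?l = "\<lambda>xs. walk F (F k) xs k"
  let ?s = "\<lambda>xs :: nat list. (- 1) ^ length xs :: quat"
  have diag: "walk_sum F (?U - set xs) (F k) k = gdet F (insert k (?U - set xs))" for xs
    using walk_sum_diagonal[OF F, of "insert k (?U - set xs)" k] U(1,2)
    by (simp add: insert_Diff_if Diff_insert0)
  have "(\<Sum>xs\<in>distinct_lists ?U. ?s xs * ?l xs * walk_sum F (?U - set xs) (F k) j)
     = (\<Sum>xs\<in>distinct_lists ?U. \<Sum>ys\<in>distinct_lists (?U - set xs).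
         ?s xs * ?l xs * (?s ys * ?w ys * gdet F (?U - set xs - set ys)))"
    by (simp only: walk_sum_def sum_distrib_left)
  also have "\<dots> = (\<Sum>ys\<in>distinct_lists ?U. \<Sum>xs\<in>distinct_lists (?U - set ys).
         ?s xs * ?l xs * (?s ys * ?w ys * gdet F (?U - set xs - set ys)))"
    by (rule sum_distinct_lists_swap[OF U(1)])
  also have "\<dots> = (\<Sum>ys\<in>distinct_lists ?U. walk_sum F (?U - set ys) (F k) k * (?s ys * ?w ys))"
  proof (rule sum.cong[OF refl])
    fix ys :: "nat list"
    have "?s xs * ?l xs * (?s ys * ?w ys * gdet F (?U - set xs - set ys))
        = ?s xs * ?l xs * gdet F (?U - set ys - set xs) * (?s ys * ?w ys)" for xs
    proof -
      have "?U - set xs - set ys = ?U - set ys - set xs" by auto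
      moreover have "finite (?U - set ys - set xs)" using U(1) by simp
      ultimately show ?thesis
        using qcnj_fixed_central[OF gdet_real[OF F], of "?U - set ys - set xs" "?s ys * ?w ys"]
        by (simp only: mult.assoc)
    qed
    then show "(\<Sum>xs\<in>distinct_lists (?U - set ys).
         ?s xs * ?l xs * (?s ys * ?w ys * gdet F (?U - set xs - set ys)))
       = walk_sum F (?U - set ys) (F k) k * (?s ys * ?w ys)"
      by (simp only: walk_sum_def sum_distrib_right)
  qed
  also have "\<dots> = (\<Sum>ys\<in>distinct_lists ?U. ?s ys * ?w ys * gdet F (insert k (?U - set ys)))"
    unfolding diag
    by (intro sum.cong refl qcnj_fixed_central gdet_real F) (use U(1) in simp)
  finally show ?thesis
    by (subst U(3), subst walk_sum_insert[OF U(1,2)]) simp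
qed

section \<open>Sums of principal minors\<close>

lemma finite_Lset [simp]: "finite (Lset p n)"
  by (rule finite_subset[of _ "Pow {..<n}"]) (auto simp: Lset_def)

lemma finite_Iset [simp]: "finite (Iset p n j)"
  by (rule finite_subset[OF _ finite_Lset[of p n]]) (auto simp: Iset_def)

lemma Iset_memD:
  assumes "S \<in> Iset p n j"
  shows "S \<subseteq> {..<n}" "finite S" "card S = p" "j \<in> S"
  using assms finite_subset by (auto simp: Iset_def Lset_def)

lemma sum_principal_minors_split:
  assumes "j < n"
  shows "(\<Sum>S\<in>Lset p n. f S) = (\<Sum>S\<in>Iset p n j. f S) + (\<Sum>S\<in>Iset (Suc p) n j. f (S - {j}))"
proof -
  have "(\<Sum>S\<in>Lset p n. f S) = (\<Sum>S\<in>Iset p n j. f S) + (\<Sum>S\<in>{S \<in> Lset p n. j \<notin> S}. f S)"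
    unfolding Iset_def by (subst sum.union_disjoint[symmetric]) (auto intro: sum.cong)
  also have "(\<Sum>S\<in>{S \<in> Lset p n. j \<notin> S}. f S) = (\<Sum>S\<in>Iset (Suc p) n j. f (S - {j}))"
  proof (rule sum.reindex_bij_witness[where i = "\<lambda>S. S - {j}" and j = "insert j"])
    fix S assume S: "S \<in> {S \<in> Lset p n. j \<notin> S}"
    then have "finite S" by (auto simp: Lset_def intro: finite_subset)
    then show "insert j S \<in> Iset (Suc p) n j"
      using S assms by (auto simp: Iset_def Lset_def)
    show "insert j S - {j} = S" "f (insert j S - {j}) = f S"
      using S by auto
  next
    fix S assume S: "S \<in> Iset (Suc p) n j"
    show "insert j (S - {j}) = S"
      using Iset_memD(4)[OF S] by auto
    show "S - {j} \<in> {S \<in> Lset p n. j \<notin> S}"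
      using Iset_memD[OF S] by (auto simp: Lset_def)
  qed
  finally show ?thesis .
qed

text \<open>Marking a point \<open>l\<close> outside \<open>S\<close> is the same as marking a point
  other than \<open>j\<close> of \<open>insert l S\<close>. This matches the terms that cancel in
  \<open>sum_walk_sum_row_combination\<close>.\<close>

lemma sum_Iset_shift:
  assumes "j < n"
  shows "(\<Sum>S\<in>Iset p n j. \<Sum>l\<in>{..<n} - S. f (S - {j}) l)
    = (\<Sum>S\<in>Iset (Suc p) n j. \<Sum>l\<in>S - {j}. f (S - {j} - {l}) l)"
proof -
  let ?A = "SIGMA S:Iset p n j. {..<n} - S" and ?B = "SIGMA S:Iset (Suc p) n j. S - {j}"
  have "(\<Sum>(S, l)\<in>?A. f (S - {j}) l) = (\<Sum>(S, l)\<in>?B. f (S - {j} - {l}) l)"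
  proof (rule sum.reindex_bij_witness[where i = "\<lambda>(S, l). (S - {l}, l)" and j = "\<lambda>(S, l). (insert l S, l)"])
    fix a assume "a \<in> ?A"
    then obtain S l where a: "a = (S, l)" "S \<in> Iset p n j" "l < n" "l \<notin> S" by auto
    note S = Iset_memD[OF a(2)]
    show "(case (case a of (S, l) \<Rightarrow> (insert l S, l)) of (S, l) \<Rightarrow> (S - {l}, l)) = a"
      using a by auto
    have "insert l S - {j} - {l} = S - {j}"
      using a by auto
    then show "(case (case a of (S, l) \<Rightarrow> (insert l S, l)) of (S, l) \<Rightarrow> f (S - {j} - {l}) l) =
        (case a of (S, l) \<Rightarrow> f (S - {j}) l)"
      using a by simp
    show "(case a of (S, l) \<Rightarrow> (insert l S, l)) \<in> ?B"
      using a S by (auto simp: Iset_def Lset_def)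
  next
    fix b assume "b \<in> ?B"
    then obtain S l where b: "b = (S, l)" "S \<in> Iset (Suc p) n j" "l \<in> S" "l \<noteq> j" by auto
    note S = Iset_memD[OF b(2)]
    show "(case (case b of (S, l) \<Rightarrow> (S - {l}, l)) of (S, l) \<Rightarrow> (insert l S, l)) = b"
      using b by auto
    show "(case b of (S, l) \<Rightarrow> (S - {l}, l)) \<in> ?A"
      using b S by (auto simp: Iset_def Lset_def)
  qed
  moreover have "finite S" if "S \<in> Iset p' n j" for S p'
    by (rule Iset_memD(2)[OF that])
  ultimately show ?thesis
    by (simp add: sum.Sigma)
qed

text \<open>The sums of the principal minors of size \<open>p\<close> are the coefficients of \<open>det (z + F)\<close>; this is
  the coefficientwise form of \<open>y (z + F) adj (z + F) = det (z + F) y\<close>.\<close>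

lemma sum_walk_sum_row_combination:
  assumes F: "qadj F = F" and j: "j < n"
  shows "(\<Sum>S\<in>Iset p n j. walk_sum F (S - {j}) (\<lambda>k. \<Sum>l<n. y l * F l k) j)
       + (\<Sum>S\<in>Iset (Suc p) n j. walk_sum F (S - {j}) y j)
     = y j * (\<Sum>S\<in>Lset p n. gdet F S)"
proof -
  let ?f = "\<lambda>T l. y l * walk_sum F T (F l) j"
  have 1: "walk_sum F (S - {j}) (\<lambda>k. \<Sum>l<n. y l * F l k) j
      = y j * gdet F S + (\<Sum>l\<in>{..<n} - S. ?f (S - {j}) l)" if "S \<in> Iset p n j" for S
  proof -
    note S = Iset_memD[OF that]
    have "walk_sum F (S - {j}) (\<lambda>k. \<Sum>l<n. y l * F l k) j = (\<Sum>l<n. ?f (S - {j}) l)"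
      by (rule walk_sum_linear)
    also have "\<dots> = (\<Sum>l\<in>{..<n} - S. ?f (S - {j}) l) + (\<Sum>l\<in>S. ?f (S - {j}) l)"
      by (rule sum.subset_diff) (use S in auto)
    \<comment> \<open>Among the rows with index in \<open>S\<close>, row \<open>j\<close> yields the
      minor and the others vanish by \<open>walk_sum_off_diagonal\<close>.\<close>
    also have "(\<Sum>l\<in>S. ?f (S - {j}) l) = ?f (S - {j}) j + (\<Sum>l\<in>S - {j}. ?f (S - {j}) l)"
      using S by (intro sum.remove) auto
    also have "(\<Sum>l\<in>S - {j}. ?f (S - {j}) l) = 0"
      using S by (intro sum.neutral ballI) (simp add: walk_sum_off_diagonal[OF F])
    finally show ?thesis
      using S by (simp add: walk_sum_diagonal[OF F])
  qed
  have 2: "walk_sum F (S - {j}) y j = y j * gdet F (S - {j}) - (\<Sum>l\<in>S - {j}. ?f (S - {j} - {l}) l)"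
    if "S \<in> Iset (Suc p) n j" for S
    using Iset_memD(2)[OF that] by (intro walk_sum_step) simp
  \<comment> \<open>The terms with \<open>l\<close> outside \<open>S\<close> in \<open>1\<close>
    cancel those of \<open>2\<close> after the shift. What remains is \<open>y j\<close> times the
    minors with and without \<open>j\<close>.\<close>
  show ?thesis
    using sum_Iset_shift[OF j, of ?f p]
    by (simp add: 1 2 sum.distrib sum_subtractf sum_principal_minors_split[OF j] sum_distrib_left distrib_left)
qed

section \<open>Gram matrices\<close>

definition qinner :: "nat \<Rightarrow> (nat \<Rightarrow> quat) \<Rightarrow> (nat \<Rightarrow> quat) \<Rightarrow> quat" where
  "qinner s x y = (\<Sum>l<s. x l * qcnj (y l))"

lemma qinner_add_left: "qinner s (\<lambda>l. x l + y l) z = qinner s x z + qinner s y z"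
  by (simp add: qinner_def distrib_right sum.distrib)

lemma qinner_diff_left: "qinner s (\<lambda>l. x l - y l) z = qinner s x z - qinner s y z"
  by (simp add: qinner_def left_diff_distrib sum_subtractf)

lemma qinner_sum_left: "qinner s (\<lambda>l. \<Sum>t\<in>T. u t * X t l) z = (\<Sum>t\<in>T. u t * qinner s (X t) z)"
  unfolding qinner_def sum_distrib_right sum_distrib_left
  by (subst sum.swap) (simp add: mult.assoc)

lemma qinner_scale_left: "qinner s (\<lambda>l. c * x l) z = c * qinner s x z"
  by (simp add: qinner_def sum_distrib_left mult.assoc)

lemma qcnj_qinner: "qcnj (qinner s x y) = qinner s y x"
  by (simp add: qinner_def qcnj_sum)

lemma qinner_self_nonneg: "0 \<le> Re (qinner s x x)"
  unfolding qinner_def quat_Re_sum by (intro sum_nonneg Re_mult_qcnj_nonneg)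

lemma qinner_self_eq_0_iff: "qinner s x x = 0 \<longleftrightarrow> (\<forall>l<s. x l = 0)"
proof
  assume "qinner s x x = 0"
  then have "(\<Sum>l<s. Re (x l * qcnj (x l))) = 0"
    by (simp add: qinner_def quat_Re_sum[symmetric])
  then have "\<forall>l\<in>{..<s}. Re (x l * qcnj (x l)) = 0"
    by (subst (asm) sum_nonneg_eq_0_iff) (auto intro: Re_mult_qcnj_nonneg)
  then show "\<forall>l<s. x l = 0" by (simp add: Re_mult_qcnj_eq_0)
qed (simp add: qinner_def)

text \<open>One Gram-Schmidt step per index: \<open>b\<close> is the part of \<open>A j\<close>
  orthogonal to the earlier rows, and the residual \<open>a'\<close> is corrected by its component
  along \<open>b\<close>. The rows may be dependent.\<close>

lemma ex_orthogonal_projection: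
  assumes "finite S"
  shows "\<exists>u. \<forall>k\<in>S. qinner s (\<lambda>l. a l - (\<Sum>t\<in>S. u t * A t l)) (A k) = 0"
  using assms
proof (induct S arbitrary: a rule: finite_induct)
  case (insert j S)
  obtain w where w: "\<And>k. k \<in> S \<Longrightarrow> qinner s (\<lambda>l. A j l - (\<Sum>t\<in>S. w t * A t l)) (A k) = 0"
    using insert(3)[of "A j"] by blast
  obtain u where u: "\<And>k. k \<in> S \<Longrightarrow> qinner s (\<lambda>l. a l - (\<Sum>t\<in>S. u t * A t l)) (A k) = 0"
    using insert(3)[of a] by blast
  define b where "b = (\<lambda>l. A j l - (\<Sum>t\<in>S. w t * A t l))"
  define a' where "a' = (\<lambda>l. a l - (\<Sum>t\<in>S. u t * A t l))"
  \<comment> \<open>If \<open>b\<close> has norm zero, \<open>inverse 0 = 0\<close> makes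
    \<open>c\<close> zero; \<open>b\<close> then vanishes below \<open>s\<close> and orthogonality
    to it is automatic.\<close>
  define c where "c = qinner s a' b * inverse (qinner s b b)"
  define x where "x = (\<lambda>t. if t = j then c else u t - c * w t)"
  have x: "a l - (\<Sum>t\<in>insert j S. x t * A t l) = a' l - c * b l" for l
  proof -
    have "(\<Sum>t\<in>insert j S. x t * A t l) = c * A j l + (\<Sum>t\<in>S. (u t - c * w t) * A t l)"
      using insert(1,2) by (simp add: x_def) (intro sum.cong refl, auto)
    then show ?thesis
      by (simp add: a'_def b_def left_diff_distrib right_diff_distrib sum_subtractf sum_distrib_left mult.assoc)
  qed
  have orthS: "qinner s (\<lambda>l. a' l - c * b l) (A k) = 0" if "k \<in> S" for k
    using u[OF that] w[OF that]
    by (simp add: a'_def[symmetric] b_def[symmetric] qinner_diff_left qinner_scale_left)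
  have orthb: "qinner s (\<lambda>l. a' l - c * b l) b = 0"
  proof (cases "qinner s b b = 0")
    case True
    then have "b l = 0" if "l < s" for l
      using that by (simp add: qinner_self_eq_0_iff)
    then show ?thesis by (simp add: qinner_def)
  next
    case False
    then show ?thesis by (simp add: qinner_diff_left qinner_scale_left c_def mult.assoc)
  qed
  have "qinner s (\<lambda>l. a' l - c * b l) (A j) = 0"
  proof -
    let ?z = "\<lambda>l. a' l - c * b l"
    have Aj: "A j = (\<lambda>l. b l + (\<Sum>t\<in>S. w t * A t l))"
      by (simp add: b_def)
    have "qinner s (A j) ?z = qinner s b ?z + (\<Sum>t\<in>S. w t * qinner s (A t) ?z)"
      by (subst Aj) (simp only: qinner_add_left qinner_sum_left)
    also have "qinner s b ?z = 0"
      using orthb by (metis qcnj_qinner qcnj_simps(1))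
    also have "(\<Sum>t\<in>S. w t * qinner s (A t) ?z) = 0"
      using orthS by (intro sum.neutral ballI) (metis mult_zero_right qcnj_qinner qcnj_simps(1))
    finally show ?thesis by (metis add.right_neutral qcnj_qinner qcnj_simps(1))
  qed
  then have "\<forall>k\<in>insert j S. qinner s (\<lambda>l. a l - (\<Sum>t\<in>insert j S. x t * A t l)) (A k) = 0"
    unfolding x using orthS by blast
  then show ?case by blast
qed simp

lemma qmult_qadj_entry: "qmult s M (qadj A) i j = qinner s (M i) (A j)"
  by (simp add: qmult_def qadj_def qinner_def)

lemma qadj_gram: "qadj (qmult s A (qadj A)) = qmult s A (qadj A)"
  by (simp add: fun_eq_iff qmult_qadj_entry qadj_def[of "qmult s A (qadj A)"] qcnj_qinner)

definition qrows_indep :: "nat \<Rightarrow> qmat \<Rightarrow> nat set \<Rightarrow> bool" where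
  "qrows_indep s A S \<longleftrightarrow> (\<forall>c. (\<forall>l<s. (\<Sum>k\<in>S. c k * A k l) = 0) \<longrightarrow> (\<forall>k\<in>S. c k = 0))"

text \<open>Conjugation turns the right coefficients of a column relation into left coefficients of
  a row relation of the adjoint.\<close>

lemma qcols_indep_iff_rows_qadj: "qcols_indep m A J \<longleftrightarrow> qrows_indep m (qadj A) J"
proof -
  have e: "(\<Sum>j\<in>J. qcnj (c j) * qadj A j i) = qcnj (\<Sum>j\<in>J. A i j * c j)" for c i
    by (simp add: qcnj_sum qadj_def)
  have z: "qcnj x = 0 \<longleftrightarrow> x = 0" for x
    by (metis qcnj_simps(1,3))
  show ?thesis
  proof
    assume h: "qcols_indep m A J"
    show "qrows_indep m (qadj A) J"
      unfolding qrows_indep_def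
    proof (intro allI impI)
      fix c assume c: "\<forall>i<m. (\<Sum>j\<in>J. c j * qadj A j i) = 0"
      have "\<forall>i<m. (\<Sum>j\<in>J. A i j * qcnj (c j)) = 0"
        using c e[of "\<lambda>j. qcnj (c j)"] by (simp add: z)
      then show "\<forall>j\<in>J. c j = 0"
        using h[unfolded qcols_indep_def, rule_format, of "\<lambda>j. qcnj (c j)"] by (simp add: z)
    qed
  next
    assume h: "qrows_indep m (qadj A) J"
    show "qcols_indep m A J"
      unfolding qcols_indep_def
    proof (intro allI impI)
      fix c assume "\<forall>i<m. (\<Sum>j\<in>J. A i j * c j) = 0"
      then have "\<forall>i<m. (\<Sum>j\<in>J. qcnj (c j) * qadj A j i) = 0"
        by (simp add: e)
      then show "\<forall>j\<in>J. c j = 0"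
        using h[unfolded qrows_indep_def, rule_format, of "\<lambda>j. qcnj (c j)"] by (simp add: z)
    qed
  qed
qed

lemma qrows_indep_mono:
  assumes "qrows_indep s A T" "S \<subseteq> T" "finite T"
  shows "qrows_indep s A S"
  unfolding qrows_indep_def
proof (intro allI impI)
  fix c assume c: "\<forall>l<s. (\<Sum>k\<in>S. c k * A k l) = 0"
  let ?d = "\<lambda>k. if k \<in> S then c k else 0"
  have "(\<Sum>k\<in>T. ?d k * A k l) = (\<Sum>k\<in>S. c k * A k l)" for l
    by (rule sum.mono_neutral_cong_right) (use assms(2,3) in auto)
  then have "\<forall>l<s. (\<Sum>k\<in>T. ?d k * A k l) = 0"
    using c by simp
  then have "\<forall>k\<in>T. ?d k = 0"
    using assms(1)[unfolded qrows_indep_def, rule_format, of ?d] by simp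
  then show "\<forall>k\<in>S. c k = 0"
    using assms(2) by (metis subset_iff)
qed

text \<open>Let \<open>b\<close> be the residual of \<open>A j\<close> after projection onto the
  rows in \<open>S\<close>. Row \<open>j\<close> of the Gram matrix is a combination of the rows in
  \<open>S\<close>, which contribute zero, plus a row that vanishes on \<open>S\<close> and has the
  squared norm of \<open>b\<close> at \<open>j\<close>.\<close>

lemma gdet_gram_insert:
  assumes "finite S" "j \<notin> S"
  obtains u where "gdet (qmult s A (qadj A)) (insert j S) =
    qinner s (\<lambda>l. A j l - (\<Sum>t\<in>S. u t * A t l)) (\<lambda>l. A j l - (\<Sum>t\<in>S. u t * A t l))
      * gdet (qmult s A (qadj A)) S"
proof -
  let ?H = "qmult s A (qadj A)"
  obtain u where u: "\<And>k. k \<in> S \<Longrightarrow> qinner s (\<lambda>l. A j l - (\<Sum>t\<in>S. u t * A t l)) (A k) = 0"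
    using ex_orthogonal_projection[OF assms(1), of s "A j" A] by blast
  define b where "b = (\<lambda>l. A j l - (\<Sum>t\<in>S. u t * A t l))"
  have Aj: "A j = (\<lambda>l. b l + (\<Sum>t\<in>S. u t * A t l))"
    by (simp add: b_def)
  have "qinner s (A j) b = qinner s b b + (\<Sum>t\<in>S. u t * qinner s (A t) b)"
    by (subst Aj) (simp only: qinner_add_left qinner_sum_left)
  also have "(\<Sum>t\<in>S. u t * qinner s (A t) b) = 0"
    using u unfolding b_def[symmetric]
    by (intro sum.neutral ballI) (metis mult_zero_right qcnj_qinner qcnj_simps(1))
  finally have bj: "qinner s b (A j) = qinner s b b"
    by (metis add.right_neutral qcnj_qinner)
  have row: "?H j = (\<lambda>k. qinner s b (A k) + (\<Sum>t\<in>S. u t * ?H t k))"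
    unfolding fun_eq_iff qmult_qadj_entry by (subst Aj) (simp add: qinner_add_left qinner_sum_left)
  have "gdet ?H (insert j S) = walk_sum ?H S (?H j) j"
    using walk_sum_diagonal[OF qadj_gram, of "insert j S" j] assms by simp
  also have "\<dots> = walk_sum ?H S (\<lambda>k. qinner s b (A k)) j + (\<Sum>t\<in>S. u t * walk_sum ?H S (?H t) j)"
    by (subst row) (simp only: walk_sum_add walk_sum_linear)
  also have "(\<Sum>t\<in>S. u t * walk_sum ?H S (?H t) j) = 0"
    using assms(1) by (intro sum.neutral ballI) (simp add: walk_sum_off_diagonal[OF qadj_gram])
  also have "walk_sum ?H S (\<lambda>k. qinner s b (A k)) j = qinner s b (A j) * gdet ?H S"
    by (rule walk_sum_supported) (use assms(1) u in \<open>simp_all add: b_def\<close>)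
  finally show thesis
    unfolding bj by (intro that[of u]) (simp add: b_def)
qed

lemma Re_gdet_gram_nonneg:
  assumes "finite S"
  shows "0 \<le> Re (gdet (qmult s A (qadj A)) S)"
  using assms
proof (induct S rule: finite_induct)
  case (insert j S)
  obtain u where "gdet (qmult s A (qadj A)) (insert j S) =
    qinner s (\<lambda>l. A j l - (\<Sum>t\<in>S. u t * A t l)) (\<lambda>l. A j l - (\<Sum>t\<in>S. u t * A t l))
      * gdet (qmult s A (qadj A)) S"
    using insert(1,2) by (rule gdet_gram_insert)
  then show ?case
    using insert(3) by (simp add: Re_mult_fixed qcnj_qinner qinner_self_nonneg)
qed simp

lemma gdet_gram_nonzero:
  assumes "finite S" "qrows_indep s A S"
  shows "gdet (qmult s A (qadj A)) S \<noteq> 0"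
  using assms
proof (induct S rule: finite_induct)
  case (insert j S)
  obtain u where g: "gdet (qmult s A (qadj A)) (insert j S) =
    qinner s (\<lambda>l. A j l - (\<Sum>t\<in>S. u t * A t l)) (\<lambda>l. A j l - (\<Sum>t\<in>S. u t * A t l))
      * gdet (qmult s A (qadj A)) S"
    using insert(1,2) by (rule gdet_gram_insert)
  have "qrows_indep s A S"
    by (rule qrows_indep_mono[OF insert(4)]) (use insert(1) in auto)
  then have "gdet (qmult s A (qadj A)) S \<noteq> 0" by (rule insert(3))
  moreover have "\<not> (\<forall>l<s. A j l - (\<Sum>t\<in>S. u t * A t l) = 0)"
  proof
    assume z: "\<forall>l<s. A j l - (\<Sum>t\<in>S. u t * A t l) = 0"
    let ?c = "\<lambda>t. if t = j then 1 else - u t"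
    have "(\<Sum>t\<in>S. ?c t * A t l) = - (\<Sum>t\<in>S. u t * A t l)" for l
      unfolding sum_negf[symmetric] using insert(2) by (intro sum.cong refl) auto
    then have "(\<Sum>t\<in>insert j S. ?c t * A t l) = A j l - (\<Sum>t\<in>S. u t * A t l)" for l
      using insert(1,2) by simp
    then have "\<forall>l<s. (\<Sum>t\<in>insert j S. ?c t * A t l) = 0"
      using z by simp
    then have "?c j = 0"
      using insert(4)[unfolded qrows_indep_def, rule_format, of ?c j] by simp
    then show False by simp
  qed
  ultimately show ?case
    unfolding g by (simp add: qinner_self_eq_0_iff)
qed simp

text \<open>A relation among rows of \<open>A\<close> is also one of its Gram matrix. Expanding the
  resulting zero row at an index \<open>j\<close> with \<open>z j\<close> nonzero leaves only
  \<open>z j\<close> times the determinant.\<close>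

lemma gdet_gram_dependent:
  assumes S: "finite S" "\<not> qrows_indep s A S"
  shows "gdet (qmult s A (qadj A)) S = 0"
proof -
  let ?H = "qmult s A (qadj A)"
  obtain z j where z: "\<And>l. l < s \<Longrightarrow> (\<Sum>k\<in>S. z k * A k l) = 0" and j: "j \<in> S" "z j \<noteq> 0"
    using S(2) unfolding qrows_indep_def by blast
  have "(\<Sum>t\<in>S. z t * ?H t k) = qinner s (\<lambda>l. \<Sum>t\<in>S. z t * A t l) (A k)" for k
    by (simp add: qmult_qadj_entry qinner_sum_left)
  also have "\<dots> k = 0" for k
    by (simp add: qinner_def z)
  finally have zH: "(\<Sum>t\<in>S. z t * ?H t k) = 0" for k .
  have "0 = walk_sum ?H (S - {j}) (\<lambda>k. \<Sum>t\<in>S. z t * ?H t k) j"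
    by (simp add: zH walk_sum_zero)
  also have "\<dots> = (\<Sum>t\<in>S. z t * walk_sum ?H (S - {j}) (?H t) j)"
    by (rule walk_sum_linear)
  also have "\<dots> = z j * walk_sum ?H (S - {j}) (?H j) j + (\<Sum>t\<in>S - {j}. z t * walk_sum ?H (S - {j}) (?H t) j)"
    using S(1) j(1) by (rule sum.remove)
  also have "(\<Sum>t\<in>S - {j}. z t * walk_sum ?H (S - {j}) (?H t) j) = 0"
    using S(1) by (intro sum.neutral ballI) (simp add: walk_sum_off_diagonal[OF qadj_gram])
  finally show ?thesis
    using j S(1) by (simp add: walk_sum_diagonal[OF qadj_gram])
qed

section \<open>Row rank and column rank\<close>

text \<open>Gaussian elimination over a skew field: a pivot \<open>p\<close> clears the coordinate
  \<open>k\<close> from all other vectors by left multiples, and induction supplies a relation among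
  the results.\<close>

lemma ex_nontrivial_relation:
  fixes M :: "'b \<Rightarrow> 'c \<Rightarrow> 'a :: division_ring"
  assumes "finite K" "finite T" "card K < card T"
  shows "\<exists>c. (\<exists>t\<in>T. c t \<noteq> 0) \<and> (\<forall>k\<in>K. (\<Sum>t\<in>T. c t * M t k) = 0)"
  using assms
proof (induct K arbitrary: T M rule: finite_induct)
  case empty
  then have "T \<noteq> {}" by auto
  then show ?case by (intro exI[of _ "\<lambda>t. 1"]) auto
next
  case (insert k K)
  show ?case
  proof (cases "\<forall>t\<in>T. M t k = 0")
    case True
    have "card K < card T" using insert by simp
    from insert(3)[OF insert(4) this, of M] True show ?thesis by auto
  next
    case False
    then obtain p where p: "p \<in> T" "M p k \<noteq> 0" by blast
    let ?f = "\<lambda>t. M t k * inverse (M p k)"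
    have "card K < card (T - {p})" using insert p by simp
    from insert(3)[OF _ this, of "\<lambda>t l. M t l - ?f t * M p l"] insert(4)
    obtain c where c: "\<exists>t\<in>T - {p}. c t \<noteq> 0"
      "\<And>l. l \<in> K \<Longrightarrow> (\<Sum>t\<in>T - {p}. c t * (M t l - ?f t * M p l)) = 0"
      by auto
    \<comment> \<open>The coefficient at the pivot collects the multiples of the pivot vector that
      were subtracted.\<close>
    define d where "d = (\<lambda>t. if t = p then - (\<Sum>t\<in>T - {p}. c t * ?f t) else c t)"
    have sum_d: "(\<Sum>t\<in>T. d t * M t l) = (\<Sum>t\<in>T - {p}. c t * (M t l - ?f t * M p l))" for l
    proof -
      have "(\<Sum>t\<in>T. d t * M t l) = d p * M p l + (\<Sum>t\<in>T - {p}. d t * M t l)"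
        using insert(4) p(1) by (rule sum.remove)
      also have "(\<Sum>t\<in>T - {p}. d t * M t l) = (\<Sum>t\<in>T - {p}. c t * M t l)"
        by (intro sum.cong refl) (auto simp: d_def)
      finally show ?thesis
        by (simp add: d_def sum_distrib_right right_diff_distrib sum_subtractf mult.assoc)
    qed
    have "(\<Sum>t\<in>T. d t * M t l) = 0" if "l \<in> insert k K" for l
      using that c(2) p(2) by (auto simp: sum_d mult.assoc)
    moreover have "\<exists>t\<in>T. d t \<noteq> 0" using c(1) by (auto simp: d_def)
    ultimately show ?thesis by blast
  qed
qed

lemma qrows_span_insert:
  assumes "finite J" "l \<notin> J" "qrows_indep n B J" "\<not> qrows_indep n B (insert l J)"
  obtains d where "\<And>i. i < n \<Longrightarrow> B l i = (\<Sum>t\<in>J. d t * B t i)"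
proof -
  obtain e where e: "\<And>i. i < n \<Longrightarrow> e l * B l i + (\<Sum>t\<in>J. e t * B t i) = 0"
    and ne: "\<exists>k\<in>insert l J. e k \<noteq> 0"
    using assms(1,2,4) unfolding qrows_indep_def by auto
  have el: "e l \<noteq> 0"
  proof
    assume "e l = 0"
    then have "\<forall>k\<in>J. e k = 0"
      using e assms(3) unfolding qrows_indep_def by simp
    then show False using ne \<open>e l = 0\<close> by auto
  qed
  show thesis
  proof (rule that[of "\<lambda>t. - (inverse (e l) * e t)"])
    fix i assume "i < n"
    from e[OF this] have "e l * B l i = - (\<Sum>t\<in>J. e t * B t i)"
      by (simp add: eq_neg_iff_add_eq_0)
    then have "inverse (e l) * (e l * B l i) = inverse (e l) * - (\<Sum>t\<in>J. e t * B t i)"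
      by simp
    then show "B l i = (\<Sum>t\<in>J. - (inverse (e l) * e t) * B t i)"
      using el by (simp add: mult.assoc[symmetric] sum_negf sum_distrib_left)
  qed
qed

text \<open>Every column is a right combination of a largest independent set \<open>J\<close> of
  columns. If \<open>S\<close> were larger than \<open>J\<close>, its rows would satisfy a
  nontrivial relation in the columns of \<open>J\<close>, hence in all columns.\<close>

lemma row_rank_le_column_rank:
  assumes S: "S \<subseteq> {..<m}" "qrows_indep n A S"
  obtains J where "J \<subseteq> {..<n}" "card J = card S" "qrows_indep m (qadj A) J"
proof -
  have finS: "finite S" using S(1) finite_subset by blast
  let ?P = "\<lambda>J. J \<subseteq> {..<n} \<and> qrows_indep m (qadj A) J"
  have "?P {}" by (simp add: qrows_indep_def)
  moreover have "\<forall>J. ?P J \<longrightarrow> card J < Suc n"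
    by (metis card_lessThan card_mono finite_lessThan le_imp_less_Suc)
  ultimately have "\<exists>J. ?P J \<and> (\<forall>K. ?P K \<longrightarrow> card K \<le> card J)"
    by (rule ex_has_greatest_nat)
  then obtain J where J: "?P J" and mx: "\<And>K. ?P K \<Longrightarrow> card K \<le> card J"
    by auto
  have finJ: "finite J" using J finite_subset by blast
  have "\<exists>d. \<forall>i<m. qadj A l i = (\<Sum>t\<in>J. d t * qadj A t i)" if l: "l < n" for l
  proof (cases "l \<in> J")
    case True
    then show ?thesis
      using finJ by (intro exI[of _ "\<lambda>t. if t = l then 1 else 0"])
        (simp add: if_distrib[of "\<lambda>x. x * _"] cong: if_cong)
  next
    case False
    have "\<not> qrows_indep m (qadj A) (insert l J)"
      using mx[of "insert l J"] J l False finJ by auto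
    with qrows_span_insert[OF finJ False conjunct2[OF J]]
    obtain e where "\<And>i. i < m \<Longrightarrow> qadj A l i = (\<Sum>t\<in>J. e t * qadj A t i)" by blast
    then show ?thesis by auto
  qed
  then have "\<forall>l. \<exists>d. l < n \<longrightarrow> (\<forall>i<m. qadj A l i = (\<Sum>t\<in>J. d t * qadj A t i))"
    by blast
  from choice[OF this]
  obtain d where d: "\<And>l i. l < n \<Longrightarrow> i < m \<Longrightarrow> qadj A l i = (\<Sum>t\<in>J. d l t * qadj A t i)"
    by blast
  have A: "A i l = (\<Sum>t\<in>J. A i t * qcnj (d l t))" if "l < n" "i < m" for i l
  proof -
    have "A i l = qcnj (qadj A l i)" by (simp add: qadj_def)
    also have "\<dots> = (\<Sum>t\<in>J. A i t * qcnj (d l t))"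
      by (subst d[OF that]) (simp add: qcnj_sum qadj_def)
    finally show ?thesis .
  qed
  have "card S \<le> card J"
  proof (rule ccontr)
    assume "\<not> card S \<le> card J"
    then obtain c where c: "\<exists>k\<in>S. c k \<noteq> 0" "\<And>t. t \<in> J \<Longrightarrow> (\<Sum>k\<in>S. c k * A k t) = 0"
      using ex_nontrivial_relation[OF finJ finS, of A] by auto
    have "(\<Sum>k\<in>S. c k * A k l) = 0" if l: "l < n" for l
    proof -
      have "(\<Sum>k\<in>S. c k * A k l) = (\<Sum>k\<in>S. \<Sum>t\<in>J. c k * A k t * qcnj (d l t))"
        using A[OF l] S(1) by (intro sum.cong refl) (simp add: sum_distrib_left mult.assoc subset_iff)
      also have "\<dots> = (\<Sum>t\<in>J. (\<Sum>k\<in>S. c k * A k t) * qcnj (d l t))"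
        by (subst sum.swap) (simp add: sum_distrib_right)
      finally show ?thesis by (simp add: c(2))
    qed
    then show False using S(2)[unfolded qrows_indep_def, rule_format, of c] c(1) by auto
  qed
  then obtain K where "K \<subseteq> J" "card K = card S"
    using obtain_subset_with_card_n by metis
  then show thesis
    using J finJ by (intro that[of K]) (auto intro: qrows_indep_mono)
qed

lemma qadj_qadj [simp]: "qadj (qadj A) = A"
  by (simp add: qadj_def)

lemma qrank_attained: "\<exists>J\<subseteq>{..<n}. qcols_indep m A J \<and> card J = qrank m n A"
  and qrank_ge: "J \<subseteq> {..<n} \<Longrightarrow> qcols_indep m A J \<Longrightarrow> card J \<le> qrank m n A"
proof -
  let ?X = "{card J | J. J \<subseteq> {..<n} \<and> qcols_indep m A J}"
  have "?X \<subseteq> {..n}"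
    by (auto intro: order_trans[OF card_mono[OF finite_lessThan]])
  then have fin: "finite ?X" by (rule finite_subset) simp
  have "card ({} :: nat set) \<in> ?X" by (force simp: qcols_indep_def)
  then have "Max ?X \<in> ?X" using fin by (intro Max_in) auto
  then show "\<exists>J\<subseteq>{..<n}. qcols_indep m A J \<and> card J = qrank m n A"
    unfolding qrank_def by auto
  show "card J \<le> qrank m n A" if "J \<subseteq> {..<n}" "qcols_indep m A J"
    unfolding qrank_def using fin that by (intro Max_ge) auto
qed

lemma qrank_rows_dependent:
  assumes "S \<subseteq> {..<m}" "qrank m n A < card S"
  shows "\<not> qrows_indep n A S"
  using assms row_rank_le_column_rank[of S m n A] qrank_ge[of _ n m A]
  by (metis not_le qcols_indep_iff_rows_qadj)

lemma qrank_rows_indep: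
  obtains S where "S \<in> Lset (qrank m n A) m" "qrows_indep n A S"
proof -
  obtain J where J: "J \<subseteq> {..<n}" "qcols_indep m A J" "card J = qrank m n A"
    using qrank_attained by blast
  obtain S where "S \<subseteq> {..<m}" "card S = card J" "qrows_indep n (qadj (qadj A)) S"
    by (rule row_rank_le_column_rank[OF J(1), of m "qadj A"]) (use J(2) in \<open>auto simp: qcols_indep_iff_rows_qadj\<close>)
  then show thesis using J(3) by (intro that[of S]) (auto simp: Lset_def)
qed

lemma sum_gdet_gram_real:
  "qcnj (\<Sum>S\<in>Lset p m. gdet (qmult n A (qadj A)) S) = (\<Sum>S\<in>Lset p m. gdet (qmult n A (qadj A)) S)"
  unfolding qcnj_sum
  by (intro sum.cong refl gdet_real qadj_gram) (auto simp: Lset_def intro: finite_subset)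

text \<open>All summands are real and nonnegative, so a zero sum would make each of them zero; but
  some set of rows of this size is independent and has a nonzero minor.\<close>

lemma sum_gdet_gram_nonzero:
  "(\<Sum>S\<in>Lset (qrank m n A) m. gdet (qmult n A (qadj A)) S) \<noteq> 0"
proof
  let ?H = "qmult n A (qadj A)" and ?L = "Lset (qrank m n A) m"
  assume "(\<Sum>S\<in>?L. gdet ?H S) = 0"
  then have "(\<Sum>S\<in>?L. Re (gdet ?H S)) = 0"
    by (simp add: quat_Re_sum[symmetric])
  moreover have fin: "finite S" if "S \<in> ?L" for S
    using that by (auto simp: Lset_def intro: finite_subset)
  ultimately have z: "\<forall>S\<in>?L. Re (gdet ?H S) = 0"
    by (subst (asm) sum_nonneg_eq_0_iff) (auto intro: Re_gdet_gram_nonneg)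
  obtain S where S: "S \<in> ?L" "qrows_indep n A S" by (rule qrank_rows_indep)
  have "gdet ?H S = 0"
    by (rule qcnj_fixed_eqI) (use z S fin in \<open>simp_all add: gdet_real qadj_gram\<close>)
  then show False using gdet_gram_nonzero[OF fin[OF S(1)] S(2)] by simp
qed

lemma sum_minors_cramer:
  fixes A :: qmat and n :: nat and g :: "nat \<Rightarrow> quat"
  assumes j: "j < m"
  defines "H \<equiv> qmult n A (qadj A)" and "y \<equiv> \<lambda>k. qinner n g (A k)"
  shows "(\<Sum>S\<in>Iset (qrank m n A) m j. walk_sum H (S - {j}) (\<lambda>k. \<Sum>l<m. y l * H l k) j)
     = y j * (\<Sum>S\<in>Lset (qrank m n A) m. gdet H S)"
proof -
  have herm: "qadj H = H" unfolding H_def by (rule qadj_gram)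
  have "walk_sum H (S - {j}) y j = 0" if "S \<in> Iset (Suc (qrank m n A)) m j" for S
  proof -
    note S = Iset_memD[OF that]
    \<comment> \<open>Projecting \<open>g\<close> onto the rows of \<open>A\<close> in
      \<open>S\<close> makes \<open>y\<close> agree on \<open>S\<close> with a combination of rows
      of \<open>H\<close>; the walk sum reads the row only there.\<close>
    obtain u where u: "\<And>k. k \<in> S \<Longrightarrow> qinner n (\<lambda>l. g l - (\<Sum>t\<in>S. u t * A t l)) (A k) = 0"
      using ex_orthogonal_projection[OF S(2), of n g A] by blast
    have "y k = (\<Sum>t\<in>S. u t * H t k)" if "k \<in> S" for k
      using u[OF that] unfolding qinner_diff_left qinner_sum_left
      by (simp add: y_def H_def qmult_qadj_entry)
    then have "walk_sum H (S - {j}) y j = walk_sum H (S - {j}) (\<lambda>k. \<Sum>t\<in>S. u t * H t k) j"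
      using S(4) by (intro walk_sum_cong) auto
    also have "\<dots> = (\<Sum>t\<in>S. u t * walk_sum H (S - {j}) (H t) j)"
      by (rule walk_sum_linear)
    also have "\<dots> = 0"
    proof (intro sum.neutral ballI)
      fix t assume t: "t \<in> S"
      have "gdet H S = 0"
        unfolding H_def using S by (intro gdet_gram_dependent qrank_rows_dependent[of S m]) auto
      then show "u t * walk_sum H (S - {j}) (H t) j = 0"
        using t S walk_sum_diagonal[OF herm S(2,4)] walk_sum_off_diagonal[OF herm, of "S - {j}" t j]
        by (cases "t = j") auto
    qed
    finally show ?thesis .
  qed
  then show ?thesis
    using sum_walk_sum_row_combination[OF herm j, where p = "qrank m n A" and y = y] by simp
qed

section \<open>The Moore-Penrose inverse\<close>

lemma qmult_assoc: "qmult n (qmult m A B) C = qmult m A (qmult n B C)"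
proof (intro ext)
  fix i j
  have "qmult n (qmult m A B) C i j = (\<Sum>k<n. \<Sum>l<m. A i l * B l k * C k j)"
    by (simp add: qmult_def sum_distrib_right)
  also have "\<dots> = qmult m A (qmult n B C) i j"
    by (subst sum.swap) (simp add: qmult_def sum_distrib_left mult.assoc)
  finally show "qmult n (qmult m A B) C i j = qmult m A (qmult n B C) i j" .
qed

lemma qadj_qmult: "qadj (qmult n A B) = qmult n (qadj B) (qadj A)"
  by (simp add: fun_eq_iff qadj_def qmult_def qcnj_sum)

lemma is_qmat_qadj: "is_qmat m n A \<Longrightarrow> is_qmat n m (qadj A)"
  by (auto simp: is_qmat_def qadj_def)

lemma is_qmat_qmult: "is_qmat m k A \<Longrightarrow> is_qmat l n B \<Longrightarrow> is_qmat m n (qmult p A B)"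
  by (auto simp: is_qmat_def qmult_def)

definition is_moore_penrose :: "nat \<Rightarrow> nat \<Rightarrow> qmat \<Rightarrow> qmat \<Rightarrow> bool" where
  "is_moore_penrose m n A X \<longleftrightarrow> is_qmat n m X \<and>
      qmult m (qmult n A X) A = A \<and> qmult n (qmult m X A) X = X \<and>
      qadj (qmult n A X) = qmult n A X \<and> qadj (qmult m X A) = qmult m X A"

text \<open>Row \<open>i\<close> of \<open>G\<close> holds the coefficients of the projection of the
  \<open>i\<close>th unit vector onto the row space of \<open>A\<close>.\<close>

lemma ex_right_gram_factor:
  assumes A: "is_qmat m n A"
  obtains G where "is_qmat n m G" "qmult m G (qmult n A (qadj A)) = qadj A"
proof -
  define e where "e = (\<lambda>i l :: nat. if l = i then 1 else 0 :: quat)"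
  have "\<forall>i. \<exists>u. \<forall>k\<in>{..<m}. qinner n (\<lambda>l. e i l - (\<Sum>t<m. u t * A t l)) (A k) = 0"
    by (intro allI ex_orthogonal_projection finite_lessThan)
  from choice[OF this]
  obtain u where u: "\<And>i k. k < m \<Longrightarrow> qinner n (\<lambda>l. e i l - (\<Sum>t<m. u i t * A t l)) (A k) = 0"
    by blast
  define G where "G = (\<lambda>i t. if i < n \<and> t < m then u i t else 0)"
  have "qmult m G (qmult n A (qadj A)) i k = qadj A i k" for i k
  proof (cases "i < n \<and> k < m")
    case True
    have "qinner n (e i) (A k) = (\<Sum>t<m. u i t * qinner n (A t) (A k))"
      using u[of k i] True unfolding qinner_diff_left qinner_sum_left by simp
    moreover have "qinner n (e i) (A k) = qadj A i k"
      using True by (simp add: qinner_def e_def qadj_def if_distrib[of "\<lambda>x. x * _"] cong: if_cong)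
    moreover have "qmult m G (qmult n A (qadj A)) i k = (\<Sum>t<m. u i t * qinner n (A t) (A k))"
      unfolding qmult_def[of m] qmult_qadj_entry using True by (intro sum.cong) (auto simp: G_def)
    ultimately show ?thesis by simp
  next
    case False
    then have "qadj A i k = 0"
      using A by (auto simp: is_qmat_def qadj_def)
    moreover have "qmult m G (qmult n A (qadj A)) i k = 0"
      using False A by (auto simp: G_def qmult_def is_qmat_def qadj_def)
    ultimately show ?thesis by simp
  qed
  then show thesis
    by (intro that[of G]) (auto simp: G_def is_qmat_def)
qed

text \<open>\<open>P\<close>, acting on row vectors, is the orthogonal projection onto the row space
  of \<open>A\<close>, and \<open>Q\<close> the one onto its column space. \<open>X\<close> is built
  so that \<open>A X = Q\<close> and \<open>X A = P\<close>, from which the conditions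
  follow.\<close>

lemma ex_moore_penrose:
  assumes A: "is_qmat m n A"
  shows "\<exists>X. is_moore_penrose m n A X"
proof -
  obtain G where G: "is_qmat n m G" "qmult m G (qmult n A (qadj A)) = qadj A"
    by (rule ex_right_gram_factor[OF A])
  obtain K where K: "is_qmat m n K" "qmult n K (qmult m (qadj A) A) = A"
    using ex_right_gram_factor[OF is_qmat_qadj[OF A]] by (metis qadj_qadj)
  define P where "P = qmult m G A"
  define Q where "Q = qmult n K (qadj A)"
  have PA: "qmult n P (qadj A) = qadj A"
    unfolding P_def qmult_assoc by (rule G(2))
  have QA: "qmult m Q A = A"
    unfolding Q_def qmult_assoc by (rule K(2))
  have AP: "qmult n A (qadj P) = A"
    using arg_cong[OF PA, of qadj] by (simp add: qadj_qmult)
  \<comment> \<open>Multiplying \<open>AP\<close> by \<open>G\<close> on the left writes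
    \<open>P\<close> as a Gram matrix, which is Hermitian.\<close>
  have "P = qmult n P (qadj P)"
    unfolding P_def qmult_assoc AP[unfolded P_def] ..
  then have P: "qadj P = P"
    by (metis qadj_gram)
  have AQ: "qmult m (qadj A) (qadj Q) = qadj A"
    using arg_cong[OF QA, of qadj] by (simp add: qadj_qmult)
  have "Q = qmult m Q (qadj Q)"
    unfolding Q_def qmult_assoc AQ[unfolded Q_def] ..
  then have Q: "qadj Q = Q"
    by (metis qadj_gram)
  define X where "X = qmult n P (qadj K)"
  have QK: "qmult n A (qadj K) = Q"
    using arg_cong[OF Q_def, of qadj] Q by (simp add: qadj_qmult)
  have AX: "qmult n A X = Q"
    unfolding X_def qmult_assoc[symmetric] AP[unfolded P] by (rule QK)
  have X: "X = qmult m G Q"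
    unfolding X_def P_def qmult_assoc QK ..
  have XA: "qmult m X A = P"
    unfolding X qmult_assoc QA P_def ..
  have "is_qmat n m X"
    unfolding X_def P_def by (intro is_qmat_qmult[OF is_qmat_qmult[OF G(1) A] is_qmat_qadj[OF K(1)]])
  moreover have "qmult n (qmult m X A) X = X"
    unfolding XA by (simp only: X P_def qmult_assoc) (simp only: X[symmetric] AX)
  ultimately show ?thesis
    unfolding is_moore_penrose_def by (intro exI[of _ X]) (simp add: AX XA P Q QA)
qed

text \<open>The products agree: \<open>A X = (A Y) (A X)\<close>, and taking adjoints reduces this
  to \<open>A Y\<close>; likewise \<open>X A = Y A\<close>. Then
  \<open>X = X A X = X A Y = Y A Y = Y\<close>.\<close>

lemma moore_penrose_unique:
  assumes X: "is_moore_penrose m n A X" and Y: "is_moore_penrose m n A Y"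
  shows "X = Y"
proof -
  note X' = X[unfolded is_moore_penrose_def] and Y' = Y[unfolded is_moore_penrose_def]
  have "qmult n A X = qmult m (qmult n A Y) (qmult n A X)"
    using Y' by (metis qmult_assoc)
  also have "\<dots> = qadj (qmult m (qmult n A X) (qmult n A Y))"
    using X' Y' by (metis qadj_qmult)
  also have "qmult m (qmult n A X) (qmult n A Y) = qmult n A Y"
    using X' by (metis qmult_assoc)
  finally have AXY: "qmult n A X = qmult n A Y" using Y' by simp
  have "qmult m X A = qmult n (qmult m X A) (qmult m Y A)"
    using Y' by (metis qmult_assoc)
  also have "\<dots> = qadj (qmult n (qmult m Y A) (qmult m X A))"
    using X' Y' by (metis qadj_qmult)
  also have "qmult n (qmult m Y A) (qmult m X A) = qmult m Y A"
    using X' by (metis qmult_assoc)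
  finally have XYA: "qmult m X A = qmult m Y A" using Y' by simp
  show ?thesis
    using X' Y' AXY XYA by (metis qmult_assoc)
qed

lemma qmp_moore_penrose:
  assumes "is_qmat m n A"
  shows "is_moore_penrose m n A (qmp m n A)"
proof -
  have "qmp m n A = (THE X. is_moore_penrose m n A X)"
    by (simp add: qmp_def is_moore_penrose_def)
  moreover obtain X where X: "is_moore_penrose m n A X"
    using ex_moore_penrose[OF assms] by blast
  ultimately show ?thesis
    using theI[of "is_moore_penrose m n A", OF X moore_penrose_unique[OF _ X]] by simp
qed

text \<open>Row \<open>i\<close> of \<open>C\<close> times the inverse of \<open>A\<close> has the
  form \<open>g\<close> times \<open>qadj A\<close> and, multiplied by the Gram matrix, becomes row
  \<open>i\<close> of \<open>C\<close> times \<open>qadj A\<close>, so that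
  \<open>sum_minors_cramer\<close> applies. The left factor will be \<open>C\<close> as well as
  \<open>B2\<close>.\<close>

lemma qmult_qmp_entry:
  assumes A: "is_qmat m n A" and j: "j < m"
  shows "qmult n C (qmp m n A) i j =
     (\<Sum>\<alpha>\<in>Iset (qrank m n A) m j.
        rdet_sub j \<alpha> (row_repl (qmult n A (qadj A)) j (qmult n C (qadj A) i)))
     / (\<Sum>\<alpha>\<in>Lset (qrank m n A) m. hdet_sub \<alpha> (qmult n A (qadj A)))"
proof -
  let ?P = "qmp m n A" and ?H = "qmult n A (qadj A)" and ?r = "qrank m n A"
  note P = qmp_moore_penrose[OF A, unfolded is_moore_penrose_def]
  define D where "D = (\<Sum>\<alpha>\<in>Lset ?r m. gdet ?H \<alpha>)"
  define g where "g = qmult m (qmult n C ?P) (qadj ?P) i"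
  have PAP: "qmult n (qmult m ?P A) ?P = ?P" and APA: "qmult m (qmult n A ?P) A = A"
    and AP: "qadj (qmult n A ?P) = qmult n A ?P" and PA: "qadj (qmult m ?P A) = qmult m ?P A"
    using P by blast+
  have "?P = qmult m ?P (qadj (qmult n A ?P))"
    unfolding AP using PAP by (simp only: qmult_assoc)
  also have "\<dots> = qmult n (qmult m ?P (qadj ?P)) (qadj A)"
    by (simp only: qadj_qmult qmult_assoc)
  finally have PPA: "?P = qmult n (qmult m ?P (qadj ?P)) (qadj A)" .
  have "qmult n C ?P = qmult n (qmult m (qmult n C ?P) (qadj ?P)) (qadj A)"
    by (subst PPA) (simp only: qmult_assoc)
  from fun_cong[OF fun_cong[OF this, of i]] have y: "qmult n C ?P i k = qinner n g (A k)" for k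
    by (simp only: qmult_qadj_entry[of n _ A] g_def)
  \<comment> \<open>With \<open>X\<close> for the inverse: since \<open>X A\<close> is Hermitian,
    the adjoint of \<open>A X A = A\<close> reads \<open>X A (qadj A) = qadj A\<close>.\<close>
  have "qmult m ?P ?H = qmult n (qadj (qmult m ?P A)) (qadj A)"
    unfolding PA by (simp only: qmult_assoc)
  also have "\<dots> = qadj (qmult m (qmult n A ?P) A)"
    by (simp only: qadj_qmult qmult_assoc)
  also have "\<dots> = qadj A"
    unfolding APA ..
  finally have "qmult m (qmult n C ?P) ?H = qmult n C (qadj A)"
    by (simp add: qmult_assoc)
  from fun_cong[OF this, of i]
  have v: "(\<lambda>k. \<Sum>l<m. qinner n g (A l) * ?H l k) = qmult n C (qadj A) i"
    by (simp only: y qmult_def[of m])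
  have "(\<Sum>\<alpha>\<in>Iset ?r m j. rdet_sub j \<alpha> (row_repl ?H j (qmult n C (qadj A) i)))
      = (\<Sum>\<alpha>\<in>Iset ?r m j. walk_sum ?H (\<alpha> - {j}) (qmult n C (qadj A) i) j)"
    by (intro sum.cong refl rdet_sub_row_repl) (auto dest: Iset_memD)
  also have "\<dots> = qmult n C ?P i j * D"
    using sum_minors_cramer[OF j, of n A g] by (simp only: v y D_def)
  finally have num: "(\<Sum>\<alpha>\<in>Iset ?r m j. rdet_sub j \<alpha> (row_repl ?H j (qmult n C (qadj A) i)))
      = qmult n C ?P i j * D" .
  have den: "(\<Sum>\<alpha>\<in>Lset ?r m. hdet_sub \<alpha> ?H) = D"
    unfolding D_def by (intro sum.cong refl hdet_sub_eq_gdet) (auto simp: Lset_def intro: finite_subset)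
  have "D \<noteq> 0" unfolding D_def by (rule sum_gdet_gram_nonzero)
  then show ?thesis
    unfolding num den by (simp add: divide_inverse mult.assoc)
qed

section \<open>Assembling the two solution formulas\<close>

lemma is_qmat_mult_qL:
  assumes "is_qmat q n B" "is_qmat m n A"
  shows "is_qmat q n (qmult n B (qL m n A))"
  using assms by (auto simp: is_qmat_def qmult_def qL_def qsub_def qid_def)

lemma sum_hdet_sub_gram_real:
  "qcnj (\<Sum>\<alpha>\<in>Lset p m. hdet_sub \<alpha> (qmult n A (qadj A))) = (\<Sum>\<alpha>\<in>Lset p m. hdet_sub \<alpha> (qmult n A (qadj A)))"
proof -
  have "(\<Sum>\<alpha>\<in>Lset p m. hdet_sub \<alpha> (qmult n A (qadj A))) = (\<Sum>\<alpha>\<in>Lset p m. gdet (qmult n A (qadj A)) \<alpha>)"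
    by (intro sum.cong refl hdet_sub_eq_gdet) (auto simp: Lset_def intro: finite_subset)
  then show ?thesis by (simp only: sum_gdet_gram_real)
qed

text \<open>Centrality lets \<open>inverse d\<close> pass \<open>b\<close>; then
  \<open>inverse e * inverse d\<close> is the inverse of \<open>d * e\<close>, since inversion
  reverses the order.\<close>

lemma mult_divide_divide_central:
  fixes a :: "'a :: division_ring"
  assumes "\<And>x. inverse d * x = x * inverse d"
  shows "(a / d) * (b / e) = (a * b) / (d * e)"
proof -
  have "(a / d) * (b / e) = a * (inverse d * (b * inverse e))"
    by (simp add: divide_inverse mult.assoc)
  also have "\<dots> = a * b * (inverse e * inverse d)"
    by (subst assms) (simp add: mult.assoc)
  also have "inverse e * inverse d = inverse (d * e)"
    by (cases "d = 0 \<or> e = 0") (auto simp: nonzero_inverse_mult_distrib)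
  finally show ?thesis by (simp add: divide_inverse)
qed

theorem theorem5p8:
  fixes r s q m r1 r2 r3 :: nat and B1 B2 C N :: qmat
  assumes B1: "is_qmat r s B1" and rk1: "qrank r s B1 = r1"
    and B2: "is_qmat q s B2" and rk2: "qrank q s B2 = r2"
    and C: "is_qmat m s C"
    and N: "N = qmult s B2 (qL r s B1)" and rk3: "qrank q s N = r3"
  defines "X1 \<equiv> qsub (qmult s C (qmp r s B1))
                    (qmult s (qmult q (qmult s C (qmp q s N)) B2) (qmp r s B1))"
    and "X2 \<equiv> qmult s C (qmp q s N)"
    and "C1 \<equiv> qmult s C (qadj B1)"
    and "C2 \<equiv> qmult s C (qadj N)"
    and "B2t \<equiv> qmult s B2 (qadj B1)"
    and "BB \<equiv> qmult s B1 (qadj B1)"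
    and "NN \<equiv> qmult s N (qadj N)"
  shows "(\<forall>i<m. \<forall>j<r. X1 i j =
            (\<Sum>\<alpha>\<in>Iset r1 r j. rdet_sub j \<alpha> (row_repl BB j (C1 i)))
              / (\<Sum>\<alpha>\<in>Lset r1 r. hdet_sub \<alpha> BB)
          - (\<Sum>t<q. (\<Sum>\<alpha>\<in>Iset r3 q t. rdet_sub t \<alpha> (row_repl NN t (C2 i)))
                     * (\<Sum>\<alpha>\<in>Iset r1 r j. rdet_sub j \<alpha> (row_repl BB j (B2t t))))
              / ((\<Sum>\<alpha>\<in>Lset r3 q. hdet_sub \<alpha> NN) * (\<Sum>\<alpha>\<in>Lset r1 r. hdet_sub \<alpha> BB)))
       \<and> (\<forall>g<m. \<forall>f<q. X2 g f =
            (\<Sum>\<alpha>\<in>Iset r3 q f. rdet_sub f \<alpha> (row_repl NN f (C2 g)))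
              / (\<Sum>\<alpha>\<in>Lset r3 q. hdet_sub \<alpha> NN))"
proof -
  have Nmat: "is_qmat q s N"
    unfolding N using B2 B1 by (rule is_qmat_mult_qL)
  define dB dN where "dB = (\<Sum>\<alpha>\<in>Lset r1 r. hdet_sub \<alpha> BB)" and "dN = (\<Sum>\<alpha>\<in>Lset r3 q. hdet_sub \<alpha> NN)"
  have entB: "qmult s M (qmp r s B1) i j =
      (\<Sum>\<alpha>\<in>Iset r1 r j. rdet_sub j \<alpha> (row_repl BB j (qmult s M (qadj B1) i))) / dB" if "j < r" for M i j
    using qmult_qmp_entry[OF B1 that, of M i] by (simp only: rk1 BB_def dB_def)
  have entN: "X2 i t = (\<Sum>\<alpha>\<in>Iset r3 q t. rdet_sub t \<alpha> (row_repl NN t (C2 i))) / dN" if "t < q" for i t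
    using qmult_qmp_entry[OF Nmat that, of C i] by (simp only: rk3 NN_def dN_def X2_def C2_def)
  \<comment> \<open>A real denominator is central, which permits merging the two quotients in each
    summand into one.\<close>
  have "qcnj dN = dN"
    unfolding dN_def NN_def by (rule sum_hdet_sub_gram_real)
  then have dN: "inverse dN * x = x * inverse dN" for x
    by (intro qcnj_fixed_central qcnj_fixed_inverse)
  have "X1 i j = (\<Sum>\<alpha>\<in>Iset r1 r j. rdet_sub j \<alpha> (row_repl BB j (C1 i))) / dB
      - (\<Sum>t<q. (\<Sum>\<alpha>\<in>Iset r3 q t. rdet_sub t \<alpha> (row_repl NN t (C2 i)))
                  * (\<Sum>\<alpha>\<in>Iset r1 r j. rdet_sub j \<alpha> (row_repl BB j (B2t t)))) / (dN * dB)"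
    if j: "j < r" for i j
  proof -
    \<comment> \<open>By associativity the subtracted product is \<open>X2\<close> times the product
      of \<open>B2\<close> with the inverse of \<open>B1\<close>, and the quotient formula applies
      to each of these two factors.\<close>
    have "X1 i j = qmult s C (qmp r s B1) i j - qmult q X2 (qmult s B2 (qmp r s B1)) i j"
      by (simp add: X1_def X2_def qsub_def qmult_assoc)
    also have "qmult q X2 (qmult s B2 (qmp r s B1)) i j
        = (\<Sum>t<q. X2 i t * qmult s B2 (qmp r s B1) t j)"
      by (simp add: qmult_def[of q])
    also have "\<dots> = (\<Sum>t<q. (\<Sum>\<alpha>\<in>Iset r3 q t. rdet_sub t \<alpha> (row_repl NN t (C2 i))) / dN
        * ((\<Sum>\<alpha>\<in>Iset r1 r j. rdet_sub j \<alpha> (row_repl BB j (B2t t))) / dB))"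
      by (intro sum.cong refl arg_cong2[where f = "(*)"]) (simp_all add: entN entB[OF j] B2t_def)
    also have "\<dots> = (\<Sum>t<q. (\<Sum>\<alpha>\<in>Iset r3 q t. rdet_sub t \<alpha> (row_repl NN t (C2 i)))
                  * (\<Sum>\<alpha>\<in>Iset r1 r j. rdet_sub j \<alpha> (row_repl BB j (B2t t)))) / (dN * dB)"
      unfolding mult_divide_divide_central[OF dN] by (simp only: divide_inverse sum_distrib_right)
    finally show ?thesis
      by (simp only: entB[OF j] C1_def)
  qed
  then show ?thesis
    using entN unfolding dB_def dN_def by blast
qed

end
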